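(* Let $t\in\mathbb R\setminus\{0\}$, and let $$r(x)=D+xC_1(I_{\mathbb H_t^{N_1}}-xA_1)^{-1}B_1=D+xC_2(I_{\mathbb H_t^{N_2}}-xA_2)^{-1}B_2$$ be two minimal realizations of the $\mathbb H_t^{n\times m}$-valued rational function $r$, where in both cases $D=r(0)$. Then $N_1=N_2$ (denote the common value by $N$) and the two realizations are similar: there exists an invertible matrix $S\in\mathbb H_t^{N\times N}$ such that $$\begin{pmatrix}S&0\\0&I_{\mathbb H_t^n}\end{pmatrix}\begin{pmatrix}A_1&B_1\\C_1&D\end{pmatrix}=\begin{pmatrix}A_2&B_2\\C_2&D\end{pmatrix}\begin{pmatrix}S&0\\0&I_{\mathbb H_t^m}\end{pmatrix}.$$ Furthermore, $S$ is uniquely determined by the two realizations.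
   Context: For real $t\neq 0$, $\mathbb H_t$ is the real associative algebra of elements $q=a+bj_t$ with $a,b\in\mathbb C$, where $\mathbb C\subset\mathbb H_t$, $j_t^2=t$ and $j_t a=\overline a\, j_t$ for $a\in\mathbb C$. The map $I(a+bj_t)=\begin{pmatrix}a&tb\\ \overline b&\overline a\end{pmatrix}$ is an isomorphism of real algebras onto the set of matrices of this form. $I_{\mathbb H_t^N}$ is the identity matrix in $\mathbb H_t^{N\times N}$. The variable $x$ is real. An $\mathbb H_t^{n\times m}$-valued function $r$ of the real variable $x$, defined at $x=0$, is rational if it can be written as $r(x)=D+xC(I_{\mathbb H_t^N}-xA)^{-1}B$ with $D=r(0)$ and $(C,A,B)\in\mathbb H_t^{n\times N}\times\mathbb H_t^{N\times N}\times\mathbb H_t^{N\times m}$; such an expression is called a realization. The pair $(C,A)$ is observable if for $h\in\mathbb H_t^N$: $C(I_{\mathbb H_t^N}-xA)^{-1}h=0$ for all $x$ in some interval $(-\varepsilon,\varepsilon)$ if and only if $h=0$. The pair $(A,B)$ is controllable if for $h\in\mathbb H_t^{1\times N}$: $hA^kB=0$ for all $k=0,1,2,\ldots$ if and only if $h=0$. The realization is minimal if $(C,A)$ is observable and $(A,B)$ is controllable. *)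

theory Defs
  imports Complex_Main "Jordan_Normal_Form.Matrix"
begin

(* Ht a b stands for a + b j_t.  The real vector space structure does not involve t, so all the
   algebras H_t share this carrier; only the product below depends on t. *)
datatype ht = Ht (cpart: complex) (jpart: complex)

instantiation ht :: real_vector
begin

definition zero_ht :: ht where "0 = Ht 0 0"

definition plus_ht :: "ht \<Rightarrow> ht \<Rightarrow> ht" where
  "p + q = Ht (cpart p + cpart q) (jpart p + jpart q)"

definition uminus_ht :: "ht \<Rightarrow> ht" where
  "- p = Ht (- cpart p) (- jpart p)"

definition minus_ht :: "ht \<Rightarrow> ht \<Rightarrow> ht" where
  "p - q = Ht (cpart p - cpart q) (jpart p - jpart q)"

definition scaleR_ht :: "real \<Rightarrow> ht \<Rightarrow> ht" where
  "c *\<^sub>R p = Ht (c *\<^sub>R cpart p) (c *\<^sub>R jpart p)"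

instance
  by standard
    (simp_all add: zero_ht_def plus_ht_def uminus_ht_def minus_ht_def scaleR_ht_def
      scaleR_add_left scaleR_add_right)

end

instantiation ht :: one
begin

definition one_ht :: ht where "1 = Ht 1 0"

instance ..

end

(* (a + b j)(c + d j) = (a c + t b (cnj d)) + (a d + b (cnj c)) j, by j^2 = t and j c = (cnj c) j *)
definition ht_mult :: "real \<Rightarrow> ht \<Rightarrow> ht \<Rightarrow> ht" where
  "ht_mult t p q =
     Ht (cpart p * cpart q + of_real t * (jpart p * cnj (jpart q)))
        (cpart p * jpart q + jpart p * cnj (cpart q))"

lemma ht_mult_j_j: "ht_mult t (Ht 0 1) (Ht 0 1) = Ht (of_real t) 0"
  and ht_mult_j_left: "ht_mult t (Ht 0 1) (Ht a 0) = ht_mult t (Ht (cnj a) 0) (Ht 0 1)"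
  and ht_mult_j_right: "Ht a b = Ht a 0 + ht_mult t (Ht b 0) (Ht 0 1)"
  and ht_mult_complex: "ht_mult t (Ht a 0) (Ht b 0) = Ht (a * b) 0"
  by (simp_all add: ht_mult_def plus_ht_def)

lemma ht_mult_assoc: "ht_mult t (ht_mult t p q) s = ht_mult t p (ht_mult t q s)"
  by (simp add: ht_mult_def algebra_simps)

lemma ht_mult_add_left: "ht_mult t (p + q) s = ht_mult t p s + ht_mult t q s"
  and ht_mult_add_right: "ht_mult t p (q + s) = ht_mult t p q + ht_mult t p s"
  and ht_mult_scaleR_left: "ht_mult t (c *\<^sub>R p) q = c *\<^sub>R ht_mult t p q"
  and ht_mult_scaleR_right: "ht_mult t p (c *\<^sub>R q) = c *\<^sub>R ht_mult t p q"
  and ht_mult_one_left: "ht_mult t 1 p = p"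
  and ht_mult_one_right: "ht_mult t p 1 = p"
  by (simp_all add: ht_mult_def plus_ht_def scaleR_ht_def one_ht_def algebra_simps)

(* The product on matrices from the library needs a type class product on the entries, which
   cannot depend on the parameter t; addition, 0\<^sub>m, 1\<^sub>m and block matrices are the library's. *)
definition hmat_mult :: "real \<Rightarrow> ht mat \<Rightarrow> ht mat \<Rightarrow> ht mat" where
  "hmat_mult t A B = mat (dim_row A) (dim_col B)
     (\<lambda>(i, j). \<Sum>k<dim_row B. ht_mult t (A $$ (i, k)) (B $$ (k, j)))"

abbreviation hmat_mult_infix :: "ht mat \<Rightarrow> real \<Rightarrow> ht mat \<Rightarrow> ht mat"
    (\<open>(_ \<odot>\<^bsub>_\<^esub> _)\<close> [70, 0, 71] 70) where
  "A \<odot>\<^bsub>t\<^esub> B \<equiv> hmat_mult t A B"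

definition hmat_scaleR :: "real \<Rightarrow> ht mat \<Rightarrow> ht mat" where
  "hmat_scaleR c A = map_mat (\<lambda>p. c *\<^sub>R p) A"

primrec hmat_pow :: "real \<Rightarrow> ht mat \<Rightarrow> nat \<Rightarrow> ht mat" where
  "hmat_pow t A 0 = 1\<^sub>m (dim_row A)"
| "hmat_pow t A (Suc k) = hmat_pow t A k \<odot>\<^bsub>t\<^esub> A"

definition is_hmat_inverse :: "real \<Rightarrow> ht mat \<Rightarrow> ht mat \<Rightarrow> bool" where
  "is_hmat_inverse t A B \<longleftrightarrow>
     A \<in> carrier_mat (dim_row A) (dim_row A) \<and> B \<in> carrier_mat (dim_row A) (dim_row A) \<and>
     A \<odot>\<^bsub>t\<^esub> B = 1\<^sub>m (dim_row A) \<and> B \<odot>\<^bsub>t\<^esub> A = 1\<^sub>m (dim_row A)"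

definition hmat_invertible :: "real \<Rightarrow> ht mat \<Rightarrow> bool" where
  "hmat_invertible t A \<longleftrightarrow> (\<exists>B. is_hmat_inverse t A B)"

(* Meaningful only for invertible A; every use below is guarded accordingly. *)
definition hmat_inv :: "real \<Rightarrow> ht mat \<Rightarrow> ht mat" where
  "hmat_inv t A = (THE B. is_hmat_inverse t A B)"

definition pencil :: "nat \<Rightarrow> ht mat \<Rightarrow> real \<Rightarrow> ht mat" where
  "pencil N A x = 1\<^sub>m N - hmat_scaleR x A"

(* r is a total function, but only its values at those x where the right-hand side is defined are
   constrained; thus r is determined up to its values at finitely many x, as a rational function
   is.  By definition r is rational exactly if it has such a realization. *)
definition is_realization ::
  "real \<Rightarrow> nat \<Rightarrow> nat \<Rightarrow> (real \<Rightarrow> ht mat) \<Rightarrow> nat \<Rightarrow> ht mat \<Rightarrow> ht mat \<Rightarrow> ht mat \<Rightarrow> ht mat \<Rightarrow> bool" where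
  "is_realization t n m r N A B C D \<longleftrightarrow>
     A \<in> carrier_mat N N \<and> B \<in> carrier_mat N m \<and>
     C \<in> carrier_mat n N \<and> D \<in> carrier_mat n m \<and>
     D = r 0 \<and>
     (\<forall>x. hmat_invertible t (pencil N A x) \<longrightarrow>
        r x = D + hmat_scaleR x (C \<odot>\<^bsub>t\<^esub> hmat_inv t (pencil N A x) \<odot>\<^bsub>t\<^esub> B))"

definition observable :: "real \<Rightarrow> nat \<Rightarrow> nat \<Rightarrow> ht mat \<Rightarrow> ht mat \<Rightarrow> bool" where
  "observable t n N C A \<longleftrightarrow>
     (\<forall>h \<in> carrier_mat N 1.
        (\<exists>\<epsilon>>0. \<forall>x. - \<epsilon> < x \<and> x < \<epsilon> \<longrightarrow>
           hmat_invertible t (pencil N A x) \<and>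
           C \<odot>\<^bsub>t\<^esub> hmat_inv t (pencil N A x) \<odot>\<^bsub>t\<^esub> h = 0\<^sub>m n 1)
        \<longleftrightarrow> h = 0\<^sub>m N 1)"

definition controllable :: "real \<Rightarrow> nat \<Rightarrow> nat \<Rightarrow> ht mat \<Rightarrow> ht mat \<Rightarrow> bool" where
  "controllable t N m A B \<longleftrightarrow>
     (\<forall>h \<in> carrier_mat 1 N.
        (\<forall>k. h \<odot>\<^bsub>t\<^esub> hmat_pow t A k \<odot>\<^bsub>t\<^esub> B = 0\<^sub>m 1 m) \<longleftrightarrow> h = 0\<^sub>m 1 N)"

definition minimal_realization ::
  "real \<Rightarrow> nat \<Rightarrow> nat \<Rightarrow> (real \<Rightarrow> ht mat) \<Rightarrow> nat \<Rightarrow> ht mat \<Rightarrow> ht mat \<Rightarrow> ht mat \<Rightarrow> ht mat \<Rightarrow> bool" where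
  "minimal_realization t n m r N A B C D \<longleftrightarrow>
     is_realization t n m r N A B C D \<and> observable t n N C A \<and> controllable t N m A B"

end

theory Submission
  imports Defs "HOL-Library.Function_Algebras"
begin

text \<open>
  Write \<open>O\<^sub>i k = C\<^sub>i A\<^sub>i\<^sup>k\<close>. Everything rests on two facts about the functions \<open>x \<mapsto> C (1 - x A)\<^sup>-\<^sup>1 B\<close>
  near \<open>x = 0\<close>: their Taylor coefficients are \<open>C A\<^sup>k B\<close>, and they vanish as soon as all these
  coefficients do. The first shows that two realizations of one function share the Markov parameters
  \<open>C A\<^sup>k B\<close> (\<open>markov_parameters_eq\<close>); the second turns observability into the statement that a
  matrix \<open>X\<close> is determined by the products \<open>O\<^sub>i k X\<close> for all \<open>k\<close> (\<open>observable_cancel\<close>).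

  By this cancellation rule there is at most one \<open>S\<close> with \<open>O\<^sub>2 k S = O\<^sub>1 k\<close> for all \<open>k\<close>, and such an
  \<open>S\<close> satisfies \<open>S A\<^sub>1 = A\<^sub>2 S\<close> and \<open>S B\<^sub>1 = B\<^sub>2\<close>, because the two sides agree after multiplication by
  every \<open>O\<^sub>2 k\<close>; the case \<open>k = 0\<close> is \<open>C\<^sub>2 S = C\<^sub>1\<close>. Conversely every similarity satisfies
  \<open>O\<^sub>2 k S = O\<^sub>1 k\<close>, which gives uniqueness.

  Existence of \<open>S\<close> is where controllability enters (\<open>intertwiner_exists\<close>). The columns \<open>X\<close> for which
  some \<open>Y\<close> has \<open>O\<^sub>1 k X = O\<^sub>2 k Y\<close> for all \<open>k\<close> form a right submodule, and it contains the columns of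
  all \<open>A\<^sub>1\<^sup>k B\<^sub>1\<close> since the Markov parameters agree. Controllability says that no nonzero row
  annihilates these. Because the algebra has zero divisors for \<open>t > 0\<close>, one cannot conclude by linear
  algebra over a division ring; instead, a real linear functional that vanishes on a proper submodule
  is represented by a row through the form \<open>Re (p q)\<close>, which is nondegenerate for \<open>t \<noteq> 0\<close>
  (\<open>right_submodule_eq_carrier\<close>). So the submodule contains every column.

  Exchanging the realizations gives \<open>T\<close> with \<open>O\<^sub>1 k T = O\<^sub>2 k\<close>, and cancellation gives \<open>S T = 1\<close> and
  \<open>T S = 1\<close>. Since \<open>Re (p q) = Re (q p)\<close>, the real part of the trace is the same for \<open>S T\<close> and
  \<open>T S\<close>, that is, \<open>N\<^sub>2 = N\<^sub>1\<close>.
\<close>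

section \<open>Matrices over the algebra\<close>

lemma ht_part_simps [simp]:
  "cpart 0 = 0" "jpart 0 = 0" "cpart 1 = 1" "jpart 1 = 0"
  "cpart (p + q) = cpart p + cpart q" "jpart (p + q) = jpart p + jpart q"
  "cpart (p - q) = cpart p - cpart q" "jpart (p - q) = jpart p - jpart q"
  "cpart (- p) = - cpart p" "jpart (- p) = - jpart p"
  "cpart (c *\<^sub>R p) = c *\<^sub>R cpart p" "jpart (c *\<^sub>R p) = c *\<^sub>R jpart p"
  by (simp_all add: zero_ht_def one_ht_def plus_ht_def minus_ht_def uminus_ht_def scaleR_ht_def)

lemma ht_mult_zero [simp]: "ht_mult t 0 p = 0" "ht_mult t p 0 = 0"
  by (simp_all add: ht_mult_def zero_ht_def)

lemma ht_mult_sum_left: "ht_mult t (\<Sum>k\<in>K. f k) q = (\<Sum>k\<in>K. ht_mult t (f k) q)"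
  by (induction K rule: infinite_finite_induct) (simp_all add: ht_mult_add_left)

lemma ht_mult_sum_right: "ht_mult t p (\<Sum>k\<in>K. f k) = (\<Sum>k\<in>K. ht_mult t p (f k))"
  by (induction K rule: infinite_finite_induct) (simp_all add: ht_mult_add_right)

lemma hmat_mult_dim [simp]:
  "dim_row (A \<odot>\<^bsub>t\<^esub> B) = dim_row A" "dim_col (A \<odot>\<^bsub>t\<^esub> B) = dim_col B"
  by (simp_all add: hmat_mult_def)

lemma hmat_mult_carrier [simp]:
  "A \<in> carrier_mat n k \<Longrightarrow> B \<in> carrier_mat l m \<Longrightarrow> A \<odot>\<^bsub>t\<^esub> B \<in> carrier_mat n m"
  by (intro carrier_matI) auto

lemma hmat_mult_index [simp]:
  "i < dim_row A \<Longrightarrow> j < dim_col B \<Longrightarrow>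
   (A \<odot>\<^bsub>t\<^esub> B) $$ (i, j) = (\<Sum>k<dim_row B. ht_mult t (A $$ (i, k)) (B $$ (k, j)))"
  by (simp add: hmat_mult_def)

lemma hmat_mult_assoc:
  assumes "B \<in> carrier_mat k l" "C \<in> carrier_mat l m"
  shows "(A \<odot>\<^bsub>t\<^esub> B) \<odot>\<^bsub>t\<^esub> C = A \<odot>\<^bsub>t\<^esub> (B \<odot>\<^bsub>t\<^esub> C)"
proof (rule eq_matI)
  fix i j
  assume "i < dim_row (A \<odot>\<^bsub>t\<^esub> (B \<odot>\<^bsub>t\<^esub> C))" "j < dim_col (A \<odot>\<^bsub>t\<^esub> (B \<odot>\<^bsub>t\<^esub> C))"
  with assms show "((A \<odot>\<^bsub>t\<^esub> B) \<odot>\<^bsub>t\<^esub> C) $$ (i, j) = (A \<odot>\<^bsub>t\<^esub> (B \<odot>\<^bsub>t\<^esub> C)) $$ (i, j)"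
    by (simp add: ht_mult_sum_left ht_mult_sum_right ht_mult_assoc) (rule sum.swap)
qed simp_all

lemma hmat_mult_one_left [simp]:
  assumes "A \<in> carrier_mat n m"
  shows "1\<^sub>m n \<odot>\<^bsub>t\<^esub> A = A"
proof (rule eq_matI)
  fix i j
  assume ij: "i < dim_row A" "j < dim_col A"
  have "(1\<^sub>m n \<odot>\<^bsub>t\<^esub> A) $$ (i, j) = (\<Sum>k<n. ht_mult t (if i = k then 1 else 0) (A $$ (k, j)))"
    using ij assms by simp
  also have "\<dots> = (\<Sum>k<n. if i = k then A $$ (k, j) else 0)"
    by (intro sum.cong) (auto simp: ht_mult_one_left)
  also have "\<dots> = A $$ (i, j)"
    using ij assms by simp
  finally show "(1\<^sub>m n \<odot>\<^bsub>t\<^esub> A) $$ (i, j) = A $$ (i, j)" .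
qed (use assms in simp_all)

lemma hmat_mult_one_right [simp]:
  assumes "A \<in> carrier_mat n m"
  shows "A \<odot>\<^bsub>t\<^esub> 1\<^sub>m m = A"
proof (rule eq_matI)
  fix i j
  assume ij: "i < dim_row A" "j < dim_col A"
  have "(A \<odot>\<^bsub>t\<^esub> 1\<^sub>m m) $$ (i, j) = (\<Sum>k<m. ht_mult t (A $$ (i, k)) (if k = j then 1 else 0))"
    using ij assms by simp
  also have "\<dots> = (\<Sum>k<m. if k = j then A $$ (i, k) else 0)"
    by (intro sum.cong) (auto simp: ht_mult_one_right)
  also have "\<dots> = A $$ (i, j)"
    using ij assms by simp
  finally show "(A \<odot>\<^bsub>t\<^esub> 1\<^sub>m m) $$ (i, j) = A $$ (i, j)" .
qed (use assms in simp_all)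

lemma hmat_mult_zero_left [simp]: "B \<in> carrier_mat k m \<Longrightarrow> 0\<^sub>m n k \<odot>\<^bsub>t\<^esub> B = 0\<^sub>m n m"
  by (rule eq_matI) auto

lemma hmat_mult_zero_right [simp]: "A \<in> carrier_mat n k \<Longrightarrow> A \<odot>\<^bsub>t\<^esub> 0\<^sub>m k m = 0\<^sub>m n m"
  by (rule eq_matI) auto

lemma hmat_mult_add_right:
  assumes "B \<in> carrier_mat k m" "C \<in> carrier_mat k m"
  shows "A \<odot>\<^bsub>t\<^esub> (B + C) = A \<odot>\<^bsub>t\<^esub> B + A \<odot>\<^bsub>t\<^esub> C"
  by (rule eq_matI) (use assms in \<open>auto simp: ht_mult_add_right sum.distrib\<close>)

lemma hmat_mult_add_left:
  assumes "A \<in> carrier_mat n k" "B \<in> carrier_mat n k" "C \<in> carrier_mat k m"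
  shows "(A + B) \<odot>\<^bsub>t\<^esub> C = A \<odot>\<^bsub>t\<^esub> C + B \<odot>\<^bsub>t\<^esub> C"
  by (rule eq_matI) (use assms in \<open>auto simp: ht_mult_add_left sum.distrib\<close>)

lemma ht_mult_minus: "ht_mult t (p - p') q = ht_mult t p q - ht_mult t p' q"
  "ht_mult t p (q - q') = ht_mult t p q - ht_mult t p q'"
  by (simp_all add: ht_mult_def minus_ht_def algebra_simps)

lemma hmat_mult_minus_right:
  assumes "B \<in> carrier_mat k m" "C \<in> carrier_mat k m"
  shows "A \<odot>\<^bsub>t\<^esub> (B - C) = A \<odot>\<^bsub>t\<^esub> B - A \<odot>\<^bsub>t\<^esub> C"
  by (rule eq_matI) (use assms in \<open>auto simp: ht_mult_minus sum_subtractf\<close>)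

lemma hmat_mult_minus_left:
  assumes "A \<in> carrier_mat n k" "B \<in> carrier_mat n k" "C \<in> carrier_mat k m"
  shows "(A - B) \<odot>\<^bsub>t\<^esub> C = A \<odot>\<^bsub>t\<^esub> C - B \<odot>\<^bsub>t\<^esub> C"
  by (rule eq_matI) (use assms in \<open>auto simp: ht_mult_minus sum_subtractf\<close>)

lemma hmat_scaleR_simps [simp]:
  "dim_row (hmat_scaleR c A) = dim_row A" "dim_col (hmat_scaleR c A) = dim_col A"
  "hmat_scaleR c A \<in> carrier_mat n m \<longleftrightarrow> A \<in> carrier_mat n m"
  "i < dim_row A \<Longrightarrow> j < dim_col A \<Longrightarrow> hmat_scaleR c A $$ (i, j) = c *\<^sub>R A $$ (i, j)"
  by (auto simp: hmat_scaleR_def)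

lemma hmat_mult_scaleR_right:
  "A \<odot>\<^bsub>t\<^esub> hmat_scaleR c B = hmat_scaleR c (A \<odot>\<^bsub>t\<^esub> B)"
  by (rule eq_matI) (auto simp: ht_mult_scaleR_right scaleR_sum_right)

lemma hmat_mult_scaleR_left:
  "A \<in> carrier_mat n k \<Longrightarrow> B \<in> carrier_mat k m \<Longrightarrow>
   hmat_scaleR c A \<odot>\<^bsub>t\<^esub> B = hmat_scaleR c (A \<odot>\<^bsub>t\<^esub> B)"
  by (rule eq_matI) (auto simp: ht_mult_scaleR_left scaleR_sum_right)

lemma hmat_pow_carrier [simp]: "A \<in> carrier_mat N N \<Longrightarrow> hmat_pow t A k \<in> carrier_mat N N"
  by (induction k) auto

lemma hmat_pow_add:
  assumes A: "A \<in> carrier_mat N N"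
  shows "hmat_pow t A j \<odot>\<^bsub>t\<^esub> hmat_pow t A k = hmat_pow t A (j + k)"
proof (induction k)
  case 0
  show ?case using hmat_mult_one_right[OF hmat_pow_carrier[OF A]] A by simp
next
  case (Suc k)
  show ?case
    using Suc hmat_mult_assoc[OF hmat_pow_carrier[OF A] A, of t "hmat_pow t A j" t k] by simp
qed

lemma is_hmat_inverse_unique:
  assumes "is_hmat_inverse t A B" "is_hmat_inverse t A C"
  shows "B = C"
proof -
  let ?n = "dim_row A"
  have A: "A \<in> carrier_mat ?n ?n" and B: "B \<in> carrier_mat ?n ?n" and C: "C \<in> carrier_mat ?n ?n"
    and BA: "B \<odot>\<^bsub>t\<^esub> A = 1\<^sub>m ?n" and AC: "A \<odot>\<^bsub>t\<^esub> C = 1\<^sub>m ?n"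
    using assms by (simp_all add: is_hmat_inverse_def)
  have "B = B \<odot>\<^bsub>t\<^esub> (A \<odot>\<^bsub>t\<^esub> C)"
    using B by (simp add: AC)
  also have "\<dots> = (B \<odot>\<^bsub>t\<^esub> A) \<odot>\<^bsub>t\<^esub> C"
    using hmat_mult_assoc[OF A C] by simp
  also have "\<dots> = C"
    using C by (simp add: BA)
  finally show ?thesis .
qed

lemma is_hmat_inverse_hmat_inv:
  assumes "hmat_invertible t A"
  shows "is_hmat_inverse t A (hmat_inv t A)"
proof -
  have "\<exists>!B. is_hmat_inverse t A B"
    using assms is_hmat_inverse_unique unfolding hmat_invertible_def by blast
  then show ?thesis
    unfolding hmat_inv_def by (rule theI')
qed

definition column :: "ht mat \<Rightarrow> nat \<Rightarrow> ht mat" where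
  "column X j = mat (dim_row X) 1 (\<lambda>(i, _). X $$ (i, j))"

lemma column_carrier: "X \<in> carrier_mat n m \<Longrightarrow> column X j \<in> carrier_mat n 1"
  by (simp add: column_def)

lemma column_mult: "j < dim_col X \<Longrightarrow> column (A \<odot>\<^bsub>t\<^esub> X) j = A \<odot>\<^bsub>t\<^esub> column X j"
  by (rule eq_matI) (auto simp: column_def)

lemma mat_eq_by_columns:
  assumes "X \<in> carrier_mat n m" "Y \<in> carrier_mat n m" "\<And>j. j < m \<Longrightarrow> column X j = column Y j"
  shows "X = Y"
proof (rule eq_matI)
  fix i j
  assume "i < dim_row Y" "j < dim_col Y"
  moreover have "column X j $$ (i, 0) = column Y j $$ (i, 0)"
    using assms(2,3) \<open>j < dim_col Y\<close> by simp
  ultimately show "X $$ (i, j) = Y $$ (i, j)"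
    using assms(1,2) by (simp add: column_def)
qed (use assms in auto)

lemma sum_lessThan_add:
  fixes f :: "nat \<Rightarrow> 'a::comm_monoid_add"
  shows "(\<Sum>k<a + b. f k) = (\<Sum>k<a. f k) + (\<Sum>k<b. f (a + k))"
  by (induction b) (simp_all add: add.assoc)

lemma hmat_mult_four_block_mat:
  assumes "A1 \<in> carrier_mat nr1 n1" "B1 \<in> carrier_mat nr1 n2"
    "C1 \<in> carrier_mat nr2 n1" "D1 \<in> carrier_mat nr2 n2"
    "A2 \<in> carrier_mat n1 nc1" "B2 \<in> carrier_mat n1 nc2"
    "C2 \<in> carrier_mat n2 nc1" "D2 \<in> carrier_mat n2 nc2"
  shows "four_block_mat A1 B1 C1 D1 \<odot>\<^bsub>t\<^esub> four_block_mat A2 B2 C2 D2 =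
    four_block_mat (A1 \<odot>\<^bsub>t\<^esub> A2 + B1 \<odot>\<^bsub>t\<^esub> C2) (A1 \<odot>\<^bsub>t\<^esub> B2 + B1 \<odot>\<^bsub>t\<^esub> D2)
      (C1 \<odot>\<^bsub>t\<^esub> A2 + D1 \<odot>\<^bsub>t\<^esub> C2) (C1 \<odot>\<^bsub>t\<^esub> B2 + D1 \<odot>\<^bsub>t\<^esub> D2)"
  by (rule eq_matI) (use assms in \<open>auto simp: sum_lessThan_add\<close>)

lemma four_block_mat_inject:
  assumes "A \<in> carrier_mat n1 m1" "B \<in> carrier_mat n1 m2" "C \<in> carrier_mat n2 m1" "D \<in> carrier_mat n2 m2"
    "A' \<in> carrier_mat n1 m1" "B' \<in> carrier_mat n1 m2" "C' \<in> carrier_mat n2 m1" "D' \<in> carrier_mat n2 m2"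
  shows "four_block_mat A B C D = four_block_mat A' B' C' D' \<longleftrightarrow> A = A' \<and> B = B' \<and> C = C' \<and> D = D'"
proof
  assume eq: "four_block_mat A B C D = four_block_mat A' B' C' D'"
  have ix: "four_block_mat A B C D $$ (i, j) = four_block_mat A' B' C' D' $$ (i, j)" for i j
    by (simp only: eq)
  have "A = A'"
  proof (rule eq_matI)
    fix i j assume "i < dim_row A'" "j < dim_col A'"
    with ix[of i j] assms show "A $$ (i, j) = A' $$ (i, j)" by simp
  qed (use assms in auto)
  moreover have "B = B'"
  proof (rule eq_matI)
    fix i j assume "i < dim_row B'" "j < dim_col B'"
    with ix[of i "m1 + j"] assms show "B $$ (i, j) = B' $$ (i, j)" by simp
  qed (use assms in auto)
  moreover have "C = C'"
  proof (rule eq_matI)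
    fix i j assume "i < dim_row C'" "j < dim_col C'"
    with ix[of "n1 + i" j] assms show "C $$ (i, j) = C' $$ (i, j)" by simp
  qed (use assms in auto)
  moreover have "D = D'"
  proof (rule eq_matI)
    fix i j assume "i < dim_row D'" "j < dim_col D'"
    with ix[of "n1 + i" "m1 + j"] assms show "D $$ (i, j) = D' $$ (i, j)" by simp
  qed (use assms in auto)
  ultimately show "A = A' \<and> B = B' \<and> C = C' \<and> D = D'" by blast
qed simp

section \<open>Norms\<close>

text \<open>
  This norm is submultiplicative only up to the factor \<open>1 + \<bar>t\<bar>\<close>, which therefore accompanies every
  estimate below; the resolvent stays bounded near the origin and the powers of a matrix still grow at
  most geometrically.
\<close>

instantiation ht :: real_normed_vector
begin

definition norm_ht :: "ht \<Rightarrow> real" where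
  "norm_ht p = cmod (cpart p) + cmod (jpart p)"

definition sgn_ht :: "ht \<Rightarrow> ht" where
  "sgn_ht p = p /\<^sub>R norm p"

definition dist_ht :: "ht \<Rightarrow> ht \<Rightarrow> real" where
  "dist_ht p q = norm (p - q)"

definition uniformity_ht :: "(ht \<times> ht) filter" where
  "uniformity_ht = (INF e\<in>{0 <..}. principal {(x, y). dist x y < e})"

definition open_ht :: "ht set \<Rightarrow> bool" where
  "open_ht U \<longleftrightarrow> (\<forall>x\<in>U. eventually (\<lambda>(x', y). x' = x \<longrightarrow> y \<in> U) uniformity)"

instance
proof
  fix c :: real and p q :: ht
  show "norm p = 0 \<longleftrightarrow> p = 0"
    by (auto simp: norm_ht_def add_nonneg_eq_0_iff ht.expand)
  show "norm (p + q) \<le> norm p + norm q"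
    using norm_triangle_ineq[of "cpart p" "cpart q"] norm_triangle_ineq[of "jpart p" "jpart q"]
    by (simp add: norm_ht_def)
  show "norm (c *\<^sub>R p) = \<bar>c\<bar> * norm p"
    by (simp add: norm_ht_def algebra_simps)
qed (simp_all add: sgn_ht_def dist_ht_def uniformity_ht_def open_ht_def)

end

lemma norm_one_ht [simp]: "norm (1 :: ht) = 1"
  by (simp add: norm_ht_def)

lemma norm_ht_mult: "norm (ht_mult t p q) \<le> (1 + \<bar>t\<bar>) * (norm p * norm q)"
proof -
  have "norm (ht_mult t p q) \<le>
      (cmod (cpart p) * cmod (cpart q) + \<bar>t\<bar> * (cmod (jpart p) * cmod (jpart q))) +
      (cmod (cpart p) * cmod (jpart q) + cmod (jpart p) * cmod (cpart q))"
    unfolding norm_ht_def ht_mult_def ht.sel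
    by (intro add_mono order.trans[OF norm_triangle_ineq]) (simp_all add: norm_mult)
  also have "\<dots> \<le> (1 + \<bar>t\<bar>) * (norm p * norm q)"
    by (simp add: norm_ht_def algebra_simps)
  finally show ?thesis .
qed

definition hmat_norm :: "ht mat \<Rightarrow> real" where
  "hmat_norm A = (\<Sum>i<dim_row A. \<Sum>j<dim_col A. norm (A $$ (i, j)))"

lemma hmat_norm_nonneg [simp]: "0 \<le> hmat_norm A"
  by (simp add: hmat_norm_def sum_nonneg)

lemma norm_row_le_hmat_norm:
  "i < dim_row A \<Longrightarrow> (\<Sum>j<dim_col A. norm (A $$ (i, j))) \<le> hmat_norm A"
  unfolding hmat_norm_def
  by (rule member_le_sum[where f = "\<lambda>i. \<Sum>j<dim_col A. norm (A $$ (i, j))"]) (auto intro: sum_nonneg)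

lemma norm_index_le_hmat_norm:
  assumes "i < dim_row A" "j < dim_col A"
  shows "norm (A $$ (i, j)) \<le> hmat_norm A"
proof -
  have "norm (A $$ (i, j)) \<le> (\<Sum>j<dim_col A. norm (A $$ (i, j)))"
    using assms(2) by (intro member_le_sum[where f = "\<lambda>j. norm (A $$ (i, j))"]) auto
  then show ?thesis
    using norm_row_le_hmat_norm[OF assms(1)] by linarith
qed

lemma hmat_norm_mult:
  assumes "A \<in> carrier_mat n k" "B \<in> carrier_mat k m"
  shows "hmat_norm (A \<odot>\<^bsub>t\<^esub> B) \<le> (1 + \<bar>t\<bar>) * (hmat_norm A * hmat_norm B)"
proof -
  let ?\<tau> = "1 + \<bar>t\<bar>"
  have "hmat_norm (A \<odot>\<^bsub>t\<^esub> B) =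
      (\<Sum>i<n. \<Sum>j<m. norm (\<Sum>l<k. ht_mult t (A $$ (i, l)) (B $$ (l, j))))"
    using assms by (simp add: hmat_norm_def)
  also have "\<dots> \<le> (\<Sum>i<n. \<Sum>j<m. \<Sum>l<k. ?\<tau> * (norm (A $$ (i, l)) * norm (B $$ (l, j))))"
    by (intro sum_mono order.trans[OF norm_sum] norm_ht_mult)
  also have "\<dots> = (\<Sum>i<n. \<Sum>l<k. \<Sum>j<m. ?\<tau> * (norm (A $$ (i, l)) * norm (B $$ (l, j))))"
    by (intro sum.cong refl sum.swap)
  also have "\<dots> = ?\<tau> * (\<Sum>i<n. \<Sum>l<k. norm (A $$ (i, l)) * (\<Sum>j<m. norm (B $$ (l, j))))"
    by (simp add: sum_distrib_left)
  also have "\<dots> \<le> ?\<tau> * (\<Sum>i<n. \<Sum>l<k. norm (A $$ (i, l)) * hmat_norm B)"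
    using norm_row_le_hmat_norm[of _ B] assms
    by (intro mult_left_mono sum_mono) auto
  also have "\<dots> = ?\<tau> * (hmat_norm A * hmat_norm B)"
    using assms by (simp add: hmat_norm_def sum_distrib_right)
  finally show ?thesis .
qed

lemma hmat_norm_add:
  assumes "A \<in> carrier_mat n m" "B \<in> carrier_mat n m"
  shows "hmat_norm (A + B) \<le> hmat_norm A + hmat_norm B"
proof -
  have "hmat_norm (A + B) = (\<Sum>i<n. \<Sum>j<m. norm (A $$ (i, j) + B $$ (i, j)))"
    using assms by (simp add: hmat_norm_def)
  also have "\<dots> \<le> (\<Sum>i<n. \<Sum>j<m. norm (A $$ (i, j)) + norm (B $$ (i, j)))"
    by (intro sum_mono norm_triangle_ineq)
  also have "\<dots> = hmat_norm A + hmat_norm B"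
    using assms by (simp add: hmat_norm_def sum.distrib)
  finally show ?thesis .
qed

lemma hmat_norm_scaleR: "hmat_norm (hmat_scaleR c A) = \<bar>c\<bar> * hmat_norm A"
  by (simp add: hmat_norm_def sum_distrib_left)

lemma hmat_norm_pow:
  assumes A: "A \<in> carrier_mat N N"
  shows "hmat_norm (hmat_pow t A k) \<le> hmat_norm (1\<^sub>m N) * ((1 + \<bar>t\<bar>) * hmat_norm A) ^ k"
proof (induction k)
  case (Suc k)
  have "hmat_norm (hmat_pow t A (Suc k)) \<le>
      (1 + \<bar>t\<bar>) * (hmat_norm (hmat_pow t A k) * hmat_norm A)"
    using hmat_norm_mult[OF hmat_pow_carrier[OF A] A] by simp
  also have "\<dots> \<le> (1 + \<bar>t\<bar>) * ((hmat_norm (1\<^sub>m N) * ((1 + \<bar>t\<bar>) * hmat_norm A) ^ k) * hmat_norm A)"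
    using Suc by (intro mult_left_mono mult_right_mono) auto
  finally show ?case by (simp add: algebra_simps)
qed (use A in simp)

section \<open>Expansion of the resolvent at the origin\<close>

text \<open>
  Iterating the recursion gives \<open>f 0 = x\<^sup>k f k\<close>, which tends to zero as \<open>k\<close> grows. Taking for \<open>f k\<close> the
  \<open>k\<close>-th Taylor remainder divided by \<open>x\<^sup>k\<close>, at one fixed \<open>x\<close>, this says that a function with zero
  Taylor coefficients vanishes near the origin if these quotients grow at most geometrically.
\<close>

lemma geometric_recursion_zero:
  fixes f :: "nat \<Rightarrow> 'a::real_normed_vector"
  assumes rec: "\<And>k. f k = x *\<^sub>R f (Suc k)" and bound: "\<And>k. norm (f k) \<le> c * K ^ k"
    and small: "\<bar>x\<bar> * K \<le> 1 / 2" and K: "0 \<le> K"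
  shows "f 0 = 0"
proof -
  have f0: "f 0 = x ^ k *\<^sub>R f k" for k
  proof (induction k)
    case (Suc k)
    then show ?case using rec[of k] by (simp add: mult.commute)
  qed simp
  have c: "0 \<le> c"
    using bound[of 0] norm_ge_zero[of "f 0"] by (simp del: norm_ge_zero)
  have "norm (f 0) \<le> c * (1 / 2) ^ k" for k
  proof -
    have "norm (f 0) = \<bar>x\<bar> ^ k * norm (f k)"
      using f0[of k] by (simp add: power_abs)
    also have "\<dots> \<le> \<bar>x\<bar> ^ k * (c * K ^ k)"
      using bound by (intro mult_left_mono) auto
    also have "\<dots> = c * (\<bar>x\<bar> * K) ^ k"
      by (simp add: power_mult_distrib)
    also have "\<dots> \<le> c * (1 / 2) ^ k"
      using small K c by (intro mult_left_mono power_mono) auto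
    finally show ?thesis .
  qed
  moreover have "(\<lambda>k. c * (1 / 2) ^ k) \<longlonglongrightarrow> c * 0"
    by (intro tendsto_intros LIMSEQ_power_zero) simp
  ultimately have "norm (f 0) \<le> 0"
    using LIMSEQ_le_const by fastforce
  then show ?thesis by simp
qed

text \<open>
  Uniqueness of Taylor coefficients, where \<open>f k\<close> and \<open>g k\<close> are the \<open>k\<close>-th remainders of two functions,
  divided by \<open>x\<^sup>k\<close>: if these quotients agree away from the origin, the limit at the origin shows that
  their constant terms agree; the constant terms cancel, and division by \<open>x\<close> gives agreement of the
  next quotients. The functions are compared only
  for \<open>x \<noteq> 0\<close> because a realization contains the term \<open>x C (1 - x A)\<^sup>-\<^sup>1 B\<close>, which loses the value at
  zero.
\<close>

lemma expansion_coefficients_unique: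
  fixes f g :: "nat \<Rightarrow> real \<Rightarrow> 'a::real_normed_vector"
  assumes "0 < \<delta>"
    and f_rec: "\<And>k x. \<bar>x\<bar> < \<delta> \<Longrightarrow> f k x = a k + x *\<^sub>R f (Suc k) x"
    and g_rec: "\<And>k x. \<bar>x\<bar> < \<delta> \<Longrightarrow> g k x = b k + x *\<^sub>R g (Suc k) x"
    and f_bound: "\<And>k x. \<bar>x\<bar> < \<delta> \<Longrightarrow> norm (f k x) \<le> c k"
    and g_bound: "\<And>k x. \<bar>x\<bar> < \<delta> \<Longrightarrow> norm (g k x) \<le> d k"
    and eq: "\<And>x. 0 < \<bar>x\<bar> \<Longrightarrow> \<bar>x\<bar> < \<delta> \<Longrightarrow> f 0 x = g 0 x"
  shows "a k = b k"
proof -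
  have coeff: "a k = b k" if eq: "\<And>x. 0 < \<bar>x\<bar> \<Longrightarrow> \<bar>x\<bar> < \<delta> \<Longrightarrow> f k x = g k x" for k
  proof -
    have "norm (a k - b k) \<le> x * (c (Suc k) + d (Suc k))" if x: "0 < x" "x < \<delta>" for x
    proof -
      have "a k - b k = x *\<^sub>R (g (Suc k) x - f (Suc k) x)"
        using eq[of x] f_rec[of x k] g_rec[of x k] x by (simp add: algebra_simps)
      then have "norm (a k - b k) = x * norm (g (Suc k) x - f (Suc k) x)"
        using x by simp
      also have "\<dots> \<le> x * (d (Suc k) + c (Suc k))"
        using x f_bound[of x "Suc k"] g_bound[of x "Suc k"]
        by (intro mult_left_mono order.trans[OF norm_triangle_ineq4] add_mono) auto
      finally show ?thesis by (simp add: add.commute)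
    qed
    then have "\<forall>\<^sub>F x in at_right 0. norm (a k - b k) \<le> x * (c (Suc k) + d (Suc k))"
      using \<open>0 < \<delta>\<close> eventually_at_right_less eventually_at_right_field by blast
    moreover have "((\<lambda>x. x * (c (Suc k) + d (Suc k))) \<longlongrightarrow> 0 * (c (Suc k) + d (Suc k))) (at_right 0)"
      by (intro tendsto_intros)
    ultimately have "norm (a k - b k) \<le> 0"
      by (intro tendsto_lowerbound[of "\<lambda>x. x * (c (Suc k) + d (Suc k))" _ "at_right 0"]) auto
    then show ?thesis by simp
  qed
  have "\<forall>x. 0 < \<bar>x\<bar> \<longrightarrow> \<bar>x\<bar> < \<delta> \<longrightarrow> f k x = g k x"
  proof (induction k)
    case (Suc k)
    show ?case
    proof (intro allI impI)
      fix x :: real assume x: "0 < \<bar>x\<bar>" "\<bar>x\<bar> < \<delta>"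
      have "x *\<^sub>R f (Suc k) x = x *\<^sub>R g (Suc k) x"
        using Suc x coeff[of k] f_rec[of x k] g_rec[of x k] by simp
      then show "f (Suc k) x = g (Suc k) x" using x by simp
    qed
  qed (use eq in blast)
  then show ?thesis using coeff by blast
qed

lemma resolvent:
  assumes A: "A \<in> carrier_mat N N" and inv: "hmat_invertible t (pencil N A x)"
  shows "hmat_inv t (pencil N A x) \<in> carrier_mat N N"
    and "hmat_inv t (pencil N A x) =
      1\<^sub>m N + hmat_scaleR x (A \<odot>\<^bsub>t\<^esub> hmat_inv t (pencil N A x))"
proof -
  let ?P = "pencil N A x"
  let ?R = "hmat_inv t ?P"
  have xA: "hmat_scaleR x A \<in> carrier_mat N N"
    using A by simp
  have P: "?P \<in> carrier_mat N N"
    using minus_carrier_mat[OF xA, of "1\<^sub>m N"] by (simp add: pencil_def)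
  have inverse: "is_hmat_inverse t ?P ?R"
    by (rule is_hmat_inverse_hmat_inv[OF inv])
  show R: "?R \<in> carrier_mat N N"
    using inverse P by (auto simp: is_hmat_inverse_def)
  have "?P \<odot>\<^bsub>t\<^esub> ?R = 1\<^sub>m N"
    using inverse P by (auto simp: is_hmat_inverse_def)
  then have *: "?R - hmat_scaleR x (A \<odot>\<^bsub>t\<^esub> ?R) = 1\<^sub>m N"
    using R hmat_mult_minus_left[OF one_carrier_mat xA R, of t, folded pencil_def]
    by (simp add: hmat_mult_scaleR_left[OF A R])
  show "?R = 1\<^sub>m N + hmat_scaleR x (A \<odot>\<^bsub>t\<^esub> ?R)"
    unfolding *[symmetric] by (rule eq_matI) (use A R in auto)
qed

text \<open>
  The \<open>k\<close>-th Taylor remainder of \<open>C (1 - x A)\<^sup>-\<^sup>1 B\<close>, divided by \<open>x\<^sup>k\<close>.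
\<close>

definition expansion_remainder ::
  "real \<Rightarrow> nat \<Rightarrow> ht mat \<Rightarrow> ht mat \<Rightarrow> ht mat \<Rightarrow> nat \<Rightarrow> real \<Rightarrow> ht mat" where
  "expansion_remainder t N C A B k x =
     C \<odot>\<^bsub>t\<^esub> hmat_pow t A k \<odot>\<^bsub>t\<^esub> hmat_inv t (pencil N A x) \<odot>\<^bsub>t\<^esub> B"

locale linear_system =
  fixes t :: real and n N m :: nat and C A B :: "ht mat"
  assumes A: "A \<in> carrier_mat N N" and B: "B \<in> carrier_mat N m" and C: "C \<in> carrier_mat n N"
begin

abbreviation "resolv x \<equiv> hmat_inv t (pencil N A x)"
abbreviation "rem \<equiv> expansion_remainder t N C A B"

lemma obs_carrier [simp]: "C \<odot>\<^bsub>t\<^esub> hmat_pow t A k \<in> carrier_mat n N"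
  by (rule hmat_mult_carrier[OF C hmat_pow_carrier[OF A]])

lemma markov_carrier: "C \<odot>\<^bsub>t\<^esub> hmat_pow t A k \<odot>\<^bsub>t\<^esub> B \<in> carrier_mat n m"
  by (rule hmat_mult_carrier[OF obs_carrier B])

lemma rem_carrier:
  assumes "hmat_invertible t (pencil N A x)"
  shows "rem k x \<in> carrier_mat n m"
  unfolding expansion_remainder_def
  by (intro hmat_mult_carrier[OF hmat_mult_carrier[OF obs_carrier resolvent(1)[OF A assms]] B])

lemma rem_0:
  assumes "hmat_invertible t (pencil N A x)"
  shows "rem 0 x = C \<odot>\<^bsub>t\<^esub> resolv x \<odot>\<^bsub>t\<^esub> B"
  using A C by (simp add: expansion_remainder_def)

lemma rem_Suc:
  assumes inv: "hmat_invertible t (pencil N A x)"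
  shows "rem k x = C \<odot>\<^bsub>t\<^esub> hmat_pow t A k \<odot>\<^bsub>t\<^esub> B + hmat_scaleR x (rem (Suc k) x)"
proof -
  let ?O = "C \<odot>\<^bsub>t\<^esub> hmat_pow t A k"
  note R = resolvent(1)[OF A inv]
  have AR: "A \<odot>\<^bsub>t\<^esub> resolv x \<in> carrier_mat N N"
    by (rule hmat_mult_carrier[OF A R])
  have OR: "?O \<odot>\<^bsub>t\<^esub> (A \<odot>\<^bsub>t\<^esub> resolv x) = C \<odot>\<^bsub>t\<^esub> hmat_pow t A (Suc k) \<odot>\<^bsub>t\<^esub> resolv x"
    using hmat_mult_assoc[OF A R, of t ?O] hmat_mult_assoc[OF hmat_pow_carrier[OF A] A, of t C t k]
    by simp
  have "?O \<odot>\<^bsub>t\<^esub> resolv x = ?O \<odot>\<^bsub>t\<^esub> (1\<^sub>m N + hmat_scaleR x (A \<odot>\<^bsub>t\<^esub> resolv x))"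
    using resolvent(2)[OF A inv] by simp
  also have "\<dots> = ?O + hmat_scaleR x (C \<odot>\<^bsub>t\<^esub> hmat_pow t A (Suc k) \<odot>\<^bsub>t\<^esub> resolv x)"
    using AR by (subst hmat_mult_add_right[of _ N N])
      (simp_all add: hmat_mult_scaleR_right OR hmat_mult_one_right[OF obs_carrier])
  finally have "?O \<odot>\<^bsub>t\<^esub> resolv x =
    ?O + hmat_scaleR x (C \<odot>\<^bsub>t\<^esub> hmat_pow t A (Suc k) \<odot>\<^bsub>t\<^esub> resolv x)" .
  moreover have S: "C \<odot>\<^bsub>t\<^esub> hmat_pow t A (Suc k) \<odot>\<^bsub>t\<^esub> resolv x \<in> carrier_mat n N"
    by (rule hmat_mult_carrier[OF obs_carrier R])
  ultimately show ?thesis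
    unfolding expansion_remainder_def
    by (simp del: hmat_pow.simps
      add: hmat_mult_add_left[OF obs_carrier _ B] hmat_mult_scaleR_left[OF S B])
qed

text \<open>
  Taking norms in \<open>R = 1 + x A R\<close>, the last term is at most half the norm of \<open>R\<close> and can be moved to
  the left.
\<close>

lemma resolvent_bounded:
  assumes inv: "hmat_invertible t (pencil N A x)"
    and small: "\<bar>x\<bar> * ((1 + \<bar>t\<bar>) * hmat_norm A) \<le> 1 / 2"
  shows "hmat_norm (resolv x) \<le> 2 * hmat_norm (1\<^sub>m N)"
proof -
  note R = resolvent(1)[OF A inv]
  have "hmat_norm (resolv x) = hmat_norm (1\<^sub>m N + hmat_scaleR x (A \<odot>\<^bsub>t\<^esub> resolv x))"
    using resolvent(2)[OF A inv] by simp
  also have "\<dots> \<le> hmat_norm (1\<^sub>m N) + \<bar>x\<bar> * hmat_norm (A \<odot>\<^bsub>t\<^esub> resolv x)"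
    using A R by (auto simp: hmat_norm_scaleR[symmetric] intro!: hmat_norm_add)
  also have "\<dots> \<le> hmat_norm (1\<^sub>m N) + \<bar>x\<bar> * ((1 + \<bar>t\<bar>) * (hmat_norm A * hmat_norm (resolv x)))"
    using hmat_norm_mult[OF A R] by (intro add_left_mono mult_left_mono) auto
  also have "\<dots> = hmat_norm (1\<^sub>m N) + (\<bar>x\<bar> * ((1 + \<bar>t\<bar>) * hmat_norm A)) * hmat_norm (resolv x)"
    by (simp add: mult_ac)
  also have "\<dots> \<le> hmat_norm (1\<^sub>m N) + 1 / 2 * hmat_norm (resolv x)"
    using small by (intro add_left_mono mult_right_mono) auto
  finally show ?thesis by simp
qed

lemma rem_bounded:
  "\<exists>c. \<forall>x k. hmat_invertible t (pencil N A x) \<longrightarrow>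
    \<bar>x\<bar> * ((1 + \<bar>t\<bar>) * hmat_norm A) \<le> 1 / 2 \<longrightarrow>
    hmat_norm (rem k x) \<le> c * ((1 + \<bar>t\<bar>) * hmat_norm A) ^ k"
proof (intro exI allI impI)
  define \<tau> \<nu> where "\<tau> = 1 + \<bar>t\<bar>" and "\<nu> = hmat_norm (1\<^sub>m N)"
  have pos: "0 \<le> \<tau>" "0 \<le> \<nu>" by (simp_all add: \<tau>_def \<nu>_def)
  let ?c = "\<tau> ^ 3 * hmat_norm C * \<nu> * (2 * \<nu>) * hmat_norm B"
  fix x k
  assume inv: "hmat_invertible t (pencil N A x)"
    and small: "\<bar>x\<bar> * ((1 + \<bar>t\<bar>) * hmat_norm A) \<le> 1 / 2"
  note R = resolvent(1)[OF A inv]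
  let ?q = "(\<tau> * hmat_norm A) ^ k"
  have "hmat_norm (C \<odot>\<^bsub>t\<^esub> hmat_pow t A k) \<le> \<tau> * (hmat_norm C * hmat_norm (hmat_pow t A k))"
    unfolding \<tau>_def by (rule hmat_norm_mult[OF C hmat_pow_carrier[OF A]])
  also have "\<dots> \<le> \<tau> * (hmat_norm C * (\<nu> * ?q))"
    using pos hmat_norm_pow[OF A] by (intro mult_left_mono) (auto simp: \<tau>_def \<nu>_def)
  finally have O: "hmat_norm (C \<odot>\<^bsub>t\<^esub> hmat_pow t A k) \<le> \<tau> * (hmat_norm C * (\<nu> * ?q))" .
  have "hmat_norm (rem k x) \<le>
      \<tau> * (hmat_norm (C \<odot>\<^bsub>t\<^esub> hmat_pow t A k \<odot>\<^bsub>t\<^esub> resolv x) * hmat_norm B)"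
    unfolding expansion_remainder_def \<tau>_def
    by (rule hmat_norm_mult[OF hmat_mult_carrier[OF obs_carrier R] B])
  also have "\<dots> \<le> \<tau> * (\<tau> * (hmat_norm (C \<odot>\<^bsub>t\<^esub> hmat_pow t A k) * hmat_norm (resolv x)) * hmat_norm B)"
    using pos hmat_norm_mult[OF obs_carrier R]
    by (intro mult_left_mono mult_right_mono) (auto simp: \<tau>_def)
  also have "\<dots> \<le> \<tau> * (\<tau> * (\<tau> * (hmat_norm C * (\<nu> * ?q)) * (2 * \<nu>)) * hmat_norm B)"
    using pos O resolvent_bounded[OF inv small]
    by (intro mult_left_mono mult_right_mono mult_mono) (auto simp: \<nu>_def)
  also have "\<dots> = ?c * ?q"
    by (simp add: power3_eq_cube mult_ac)
  finally show "hmat_norm (rem k x) \<le> ?c * ((1 + \<bar>t\<bar>) * hmat_norm A) ^ k"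
    by (simp add: \<tau>_def)
qed

end

text \<open>
  The definition of observability requires the zero column to satisfy the vanishing condition, and
  that condition includes invertibility of the pencil near the origin.
\<close>

lemma observable_pencil_invertible:
  assumes "observable t n N C A"
  shows "\<exists>\<epsilon>>0. \<forall>x. \<bar>x\<bar> < \<epsilon> \<longrightarrow> hmat_invertible t (pencil N A x)"
proof -
  have "\<exists>\<epsilon>>0. \<forall>x. - \<epsilon> < x \<and> x < \<epsilon> \<longrightarrow>
      hmat_invertible t (pencil N A x) \<and>
      C \<odot>\<^bsub>t\<^esub> hmat_inv t (pencil N A x) \<odot>\<^bsub>t\<^esub> 0\<^sub>m N 1 = 0\<^sub>m n 1"
    using assms zero_carrier_mat[of N 1] unfolding observable_def by blast
  then show ?thesis
    unfolding abs_less_iff by (metis minus_less_iff)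
qed

lemma small_radius:
  assumes "0 \<le> (K :: real)"
  shows "\<exists>\<delta>>0. \<forall>x. \<bar>x\<bar> < \<delta> \<longrightarrow> \<bar>x\<bar> * K \<le> 1 / 2"
proof (intro exI[of _ "1 / (2 * (K + 1))"] conjI allI impI)
  fix x :: real assume "\<bar>x\<bar> < 1 / (2 * (K + 1))"
  then have "\<bar>x\<bar> * (K + 1) \<le> 1 / 2"
    using assms by (simp add: field_simps)
  then show "\<bar>x\<bar> * K \<le> 1 / 2"
    by (simp add: distrib_left)
qed (use assms in simp)

text \<open>
  If all coefficients \<open>C A\<^sup>k h\<close> vanish, then so does \<open>C (1 - x A)\<^sup>-\<^sup>1 h\<close> for all small \<open>x\<close>, and this is
  the condition under which observability forces \<open>h = 0\<close>.
\<close>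

lemma observable_column_zero:
  assumes obs: "observable t n N C A" and A: "A \<in> carrier_mat N N" and C: "C \<in> carrier_mat n N"
    and h: "h \<in> carrier_mat N 1"
    and zero: "\<And>k. C \<odot>\<^bsub>t\<^esub> hmat_pow t A k \<odot>\<^bsub>t\<^esub> h = 0\<^sub>m n 1"
  shows "h = 0\<^sub>m N 1"
proof -
  interpret linear_system t n N 1 C A h by unfold_locales (fact A h C)+
  let ?K = "(1 + \<bar>t\<bar>) * hmat_norm A"
  obtain \<epsilon> where \<epsilon>: "0 < \<epsilon>" "\<And>x. \<bar>x\<bar> < \<epsilon> \<Longrightarrow> hmat_invertible t (pencil N A x)"
    using observable_pencil_invertible[OF obs] by blast
  obtain \<delta> where \<delta>: "0 < \<delta>" "\<And>x. \<bar>x\<bar> < \<delta> \<Longrightarrow> \<bar>x\<bar> * ?K \<le> 1 / 2"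
    using small_radius[of ?K] by auto
  obtain c where c: "\<And>x k. hmat_invertible t (pencil N A x) \<Longrightarrow> \<bar>x\<bar> * ?K \<le> 1 / 2 \<Longrightarrow>
      hmat_norm (rem k x) \<le> c * ?K ^ k"
    using rem_bounded by blast
  have zero_near_0: "C \<odot>\<^bsub>t\<^esub> resolv x \<odot>\<^bsub>t\<^esub> h = 0\<^sub>m n 1" if x: "\<bar>x\<bar> < min \<epsilon> \<delta>" for x
  proof -
    have inv: "hmat_invertible t (pencil N A x)" and small: "\<bar>x\<bar> * ?K \<le> 1 / 2"
      using x \<epsilon>(2) \<delta>(2) by auto
    have "rem 0 x = 0\<^sub>m n 1"
    proof (rule eq_matI)
      fix i j assume "i < dim_row (0\<^sub>m n 1 :: ht mat)" "j < dim_col (0\<^sub>m n 1 :: ht mat)"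
      then have ij: "i < n" "j < 1" by simp_all
      have "rem 0 x $$ (i, j) = 0"
      proof (rule geometric_recursion_zero[where f = "\<lambda>k. rem k x $$ (i, j)" and K = ?K and x = x])
        fix k
        show "rem k x $$ (i, j) = x *\<^sub>R rem (Suc k) x $$ (i, j)"
          using ij rem_carrier[OF inv, of "Suc k"]
          by (subst rem_Suc[OF inv]) (simp add: zero)
        show "norm (rem k x $$ (i, j)) \<le> c * ?K ^ k"
          using ij rem_carrier[OF inv, of k]
          by (intro order.trans[OF norm_index_le_hmat_norm c[OF inv small]]) auto
      qed (use small in auto)
      then show "rem 0 x $$ (i, j) = 0\<^sub>m n 1 $$ (i, j)"
        using ij by simp
    qed (use rem_carrier[OF inv, of 0] in auto)
    then show ?thesis by (simp add: rem_0[OF inv])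
  qed
  then have "\<exists>\<epsilon>>0. \<forall>x. - \<epsilon> < x \<and> x < \<epsilon> \<longrightarrow>
      hmat_invertible t (pencil N A x) \<and> C \<odot>\<^bsub>t\<^esub> resolv x \<odot>\<^bsub>t\<^esub> h = 0\<^sub>m n 1"
  proof (intro exI[of _ "min \<epsilon> \<delta>"] conjI allI impI)
    fix x assume "- min \<epsilon> \<delta> < x \<and> x < min \<epsilon> \<delta>"
    then have x: "\<bar>x\<bar> < min \<epsilon> \<delta>" by linarith
    then show "hmat_invertible t (pencil N A x)" using \<epsilon>(2) by simp
    show "C \<odot>\<^bsub>t\<^esub> resolv x \<odot>\<^bsub>t\<^esub> h = 0\<^sub>m n 1" by (rule zero_near_0[OF x])
  qed (use \<epsilon>(1) \<delta>(1) in simp)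
  then show ?thesis
    using obs h unfolding observable_def by blast
qed

text \<open>
  All identities between maps into the state space are proved with this rule: the two sides agree
  after multiplication by every \<open>C A\<^sup>k\<close>.
\<close>

lemma observable_cancel:
  assumes obs: "observable t n N C A" and A: "A \<in> carrier_mat N N" and C: "C \<in> carrier_mat n N"
    and X: "X \<in> carrier_mat N p" and Y: "Y \<in> carrier_mat N p"
    and eq: "\<And>k. C \<odot>\<^bsub>t\<^esub> hmat_pow t A k \<odot>\<^bsub>t\<^esub> X = C \<odot>\<^bsub>t\<^esub> hmat_pow t A k \<odot>\<^bsub>t\<^esub> Y"
  shows "X = Y"
proof (rule mat_eq_by_columns[OF X Y])
  fix j assume j: "j < p"
  have h: "column X j - column Y j \<in> carrier_mat N 1"
    by (rule minus_carrier_mat[OF column_carrier[OF Y]])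
  have "column X j - column Y j = 0\<^sub>m N 1"
  proof (rule observable_column_zero[OF obs A C h])
    fix k
    let ?O = "C \<odot>\<^bsub>t\<^esub> hmat_pow t A k"
    have O: "?O \<in> carrier_mat n N"
      by (rule hmat_mult_carrier[OF C hmat_pow_carrier[OF A]])
    have "?O \<odot>\<^bsub>t\<^esub> column X j = ?O \<odot>\<^bsub>t\<^esub> column Y j"
      using eq[of k] j X Y by (metis carrier_matD(2) column_mult)
    then show "?O \<odot>\<^bsub>t\<^esub> (column X j - column Y j) = 0\<^sub>m n 1"
      using hmat_mult_minus_right[OF column_carrier[OF X] column_carrier[OF Y], of t ?O j j]
        minus_r_inv_mat[OF hmat_mult_carrier[OF O column_carrier[OF Y]]]
      by simp
  qed
  then have diff: "(column X j - column Y j) $$ (i, l) = 0\<^sub>m N 1 $$ (i, l)" for i l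
    by simp
  show "column X j = column Y j"
  proof (rule eq_matI)
    fix i l assume "i < dim_row (column Y j)" "l < dim_col (column Y j)"
    then show "column X j $$ (i, l) = column Y j $$ (i, l)"
      using diff[of i l] column_carrier[OF X, of j] column_carrier[OF Y, of j] by simp
  qed (use column_carrier[OF X, of j] column_carrier[OF Y, of j] in simp_all)
qed

lemma markov_parameters_eq:
  assumes R1: "is_realization t n m r N1 A1 B1 C1 D" and R2: "is_realization t n m r N2 A2 B2 C2 D"
    and "observable t n N1 C1 A1" "observable t n N2 C2 A2"
  shows "C1 \<odot>\<^bsub>t\<^esub> hmat_pow t A1 k \<odot>\<^bsub>t\<^esub> B1 = C2 \<odot>\<^bsub>t\<^esub> hmat_pow t A2 k \<odot>\<^bsub>t\<^esub> B2"
proof -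
  interpret s1: linear_system t n N1 m C1 A1 B1
    using R1 by unfold_locales (auto simp: is_realization_def)
  interpret s2: linear_system t n N2 m C2 A2 B2
    using R2 by unfold_locales (auto simp: is_realization_def)
  let ?K1 = "(1 + \<bar>t\<bar>) * hmat_norm A1" and ?K2 = "(1 + \<bar>t\<bar>) * hmat_norm A2"
  obtain \<epsilon>1 where e1: "0 < \<epsilon>1" "\<And>x. \<bar>x\<bar> < \<epsilon>1 \<Longrightarrow> hmat_invertible t (pencil N1 A1 x)"
    using observable_pencil_invertible[OF assms(3)] by blast
  obtain \<epsilon>2 where e2: "0 < \<epsilon>2" "\<And>x. \<bar>x\<bar> < \<epsilon>2 \<Longrightarrow> hmat_invertible t (pencil N2 A2 x)"
    using observable_pencil_invertible[OF assms(4)] by blast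
  obtain \<delta>1 where d1: "0 < \<delta>1" "\<And>x. \<bar>x\<bar> < \<delta>1 \<Longrightarrow> \<bar>x\<bar> * ?K1 \<le> 1 / 2"
    using small_radius[of ?K1] by auto
  obtain \<delta>2 where d2: "0 < \<delta>2" "\<And>x. \<bar>x\<bar> < \<delta>2 \<Longrightarrow> \<bar>x\<bar> * ?K2 \<le> 1 / 2"
    using small_radius[of ?K2] by auto
  obtain c1 where c1: "\<And>x k. hmat_invertible t (pencil N1 A1 x) \<Longrightarrow> \<bar>x\<bar> * ?K1 \<le> 1 / 2 \<Longrightarrow>
      hmat_norm (s1.rem k x) \<le> c1 * ?K1 ^ k"
    using s1.rem_bounded by blast
  obtain c2 where c2: "\<And>x k. hmat_invertible t (pencil N2 A2 x) \<Longrightarrow> \<bar>x\<bar> * ?K2 \<le> 1 / 2 \<Longrightarrow>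
      hmat_norm (s2.rem k x) \<le> c2 * ?K2 ^ k"
    using s2.rem_bounded by blast
  define \<delta> where "\<delta> = min (min \<epsilon>1 \<epsilon>2) (min \<delta>1 \<delta>2)"
  have inv1: "hmat_invertible t (pencil N1 A1 x)" and inv2: "hmat_invertible t (pencil N2 A2 x)"
    and small1: "\<bar>x\<bar> * ?K1 \<le> 1 / 2" and small2: "\<bar>x\<bar> * ?K2 \<le> 1 / 2" if "\<bar>x\<bar> < \<delta>" for x
    using that e1 e2 d1 d2 by (auto simp: \<delta>_def)
  show ?thesis
  proof (rule eq_matI)
    fix i j
    assume "i < dim_row (C2 \<odot>\<^bsub>t\<^esub> hmat_pow t A2 k \<odot>\<^bsub>t\<^esub> B2)" "j < dim_col (C2 \<odot>\<^bsub>t\<^esub> hmat_pow t A2 k \<odot>\<^bsub>t\<^esub> B2)"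
    then have ij: "i < n" "j < m"
      using s2.markov_carrier[of k] by auto
    show "(C1 \<odot>\<^bsub>t\<^esub> hmat_pow t A1 k \<odot>\<^bsub>t\<^esub> B1) $$ (i, j) = (C2 \<odot>\<^bsub>t\<^esub> hmat_pow t A2 k \<odot>\<^bsub>t\<^esub> B2) $$ (i, j)"
    proof (rule expansion_coefficients_unique[where \<delta> = \<delta> and k = k
          and f = "\<lambda>k x. s1.rem k x $$ (i, j)" and g = "\<lambda>k x. s2.rem k x $$ (i, j)"
          and a = "\<lambda>k. (C1 \<odot>\<^bsub>t\<^esub> hmat_pow t A1 k \<odot>\<^bsub>t\<^esub> B1) $$ (i, j)"
          and b = "\<lambda>k. (C2 \<odot>\<^bsub>t\<^esub> hmat_pow t A2 k \<odot>\<^bsub>t\<^esub> B2) $$ (i, j)"])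
      show "0 < \<delta>"
        using e1 e2 d1 d2 by (simp add: \<delta>_def)
    next
      fix k x assume x: "\<bar>x\<bar> < \<delta>"
      show "s1.rem k x $$ (i, j) =
          (C1 \<odot>\<^bsub>t\<^esub> hmat_pow t A1 k \<odot>\<^bsub>t\<^esub> B1) $$ (i, j) + x *\<^sub>R s1.rem (Suc k) x $$ (i, j)"
        using ij s1.rem_carrier[OF inv1[OF x], of "Suc k"] s1.markov_carrier[of k]
        by (subst s1.rem_Suc[OF inv1[OF x]]) (simp del: hmat_mult_index)
      show "s2.rem k x $$ (i, j) =
          (C2 \<odot>\<^bsub>t\<^esub> hmat_pow t A2 k \<odot>\<^bsub>t\<^esub> B2) $$ (i, j) + x *\<^sub>R s2.rem (Suc k) x $$ (i, j)"
        using ij s2.rem_carrier[OF inv2[OF x], of "Suc k"] s2.markov_carrier[of k]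
        by (subst s2.rem_Suc[OF inv2[OF x]]) (simp del: hmat_mult_index)
      show "norm (s1.rem k x $$ (i, j)) \<le> c1 * ?K1 ^ k"
        using ij s1.rem_carrier[OF inv1[OF x], of k]
        by (intro order.trans[OF norm_index_le_hmat_norm c1[OF inv1[OF x] small1[OF x]]]) auto
      show "norm (s2.rem k x $$ (i, j)) \<le> c2 * ?K2 ^ k"
        using ij s2.rem_carrier[OF inv2[OF x], of k]
        by (intro order.trans[OF norm_index_le_hmat_norm c2[OF inv2[OF x] small2[OF x]]]) auto
    next
      fix x :: real assume x0: "0 < \<bar>x\<bar>" and x: "\<bar>x\<bar> < \<delta>"
      note M1 = s1.rem_carrier[OF inv1[OF x], of 0] and M2 = s2.rem_carrier[OF inv2[OF x], of 0]
      have D: "D \<in> carrier_mat n m"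
        using R1 unfolding is_realization_def by blast
      have "D + hmat_scaleR x (s1.rem 0 x) = D + hmat_scaleR x (s2.rem 0 x)"
        unfolding s1.rem_0[OF inv1[OF x]] s2.rem_0[OF inv2[OF x]]
        using R1 R2 inv1[OF x] inv2[OF x] unfolding is_realization_def by metis
      then have "(D + hmat_scaleR x (s1.rem 0 x)) $$ (i, j) = (D + hmat_scaleR x (s2.rem 0 x)) $$ (i, j)"
        by simp
      then show "s1.rem 0 x $$ (i, j) = s2.rem 0 x $$ (i, j)"
        using D M1 M2 ij x0 by simp
    qed
  qed (use s1.B s1.C s2.B s2.C in simp_all)
qed

section \<open>Submodules without left annihilator\<close>

instantiation "fun" :: (type, real_vector) real_vector
begin

definition scaleR_fun :: "real \<Rightarrow> ('a \<Rightarrow> 'b) \<Rightarrow> 'a \<Rightarrow> 'b" where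
  "scaleR_fun c f = (\<lambda>x. c *\<^sub>R f x)"

instance
  by standard (auto simp: scaleR_fun_def plus_fun_def scaleR_add_left scaleR_add_right)

end

text \<open>
  Extend a basis of \<open>V\<close> by \<open>f\<close> and prescribe the values zero on the basis and one at \<open>f\<close>.
\<close>

lemma separating_functional:
  fixes V :: "'a::real_vector set"
  assumes V: "subspace V" and f: "f \<notin> V"
  obtains \<phi> :: "'a \<Rightarrow> real" where "linear \<phi>" "\<And>v. v \<in> V \<Longrightarrow> \<phi> v = 0" "\<phi> f \<noteq> 0"
proof -
  obtain B where B: "B \<subseteq> V" "independent B" "V \<subseteq> span B"
    using real_vector.maximal_independent_subset[of V] by blast
  have "span B = V"
    using real_vector.span_subspace[OF B(1,3) V] .
  then have ind: "independent (insert f B)"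
    using real_vector.independent_insertI[of f B] B(2) f by simp
  obtain \<phi> :: "'a \<Rightarrow> real"
    where \<phi>: "linear \<phi>" "\<forall>x\<in>insert f B. \<phi> x = (if x = f then 1 else 0)"
    using linear_independent_extend[OF ind, of "\<lambda>x. if x = f then 1 else 0"] by blast
  have "\<phi> v = 0" if "v \<in> V" for v
  proof (rule linear_eq_0_on_span[OF \<phi>(1)])
    show "\<And>x. x \<in> B \<Longrightarrow> \<phi> x = 0"
      using \<phi>(2) f B(1) by auto
    show "v \<in> span B"
      using that B(3) by blast
  qed
  then show ?thesis
    using that \<phi> by simp
qed

text \<open>
  For \<open>h = a + b j\<close> and \<open>p = c + d j\<close> the real part of \<open>h p\<close> is
  \<open>Re (a c) + t Re (b (cnj d))\<close>; the components of \<open>h\<close> are read off from the values of the functional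
  at \<open>1\<close>, \<open>\<i>\<close>, \<open>j\<close> and \<open>\<i> j\<close>.
\<close>

lemma ht_linear_functional:
  fixes \<psi> :: "ht \<Rightarrow> real"
  assumes "t \<noteq> 0" and "linear \<psi>"
  obtains h where "\<And>p. \<psi> p = Re (cpart (ht_mult t h p))"
proof
  fix p
  let ?h = "Ht (Complex (\<psi> (Ht 1 0)) (- \<psi> (Ht \<i> 0)))
    (Complex (\<psi> (Ht 0 1) / t) (\<psi> (Ht 0 \<i>) / t))"
  interpret linear \<psi> by fact
  have "p = Re (cpart p) *\<^sub>R Ht 1 0 + Im (cpart p) *\<^sub>R Ht \<i> 0 +
      Re (jpart p) *\<^sub>R Ht 0 1 + Im (jpart p) *\<^sub>R Ht 0 \<i>"
    by (intro ht.expand) (simp add: complex_eq_iff)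
  then have "\<psi> p = Re (cpart p) * \<psi> (Ht 1 0) + Im (cpart p) * \<psi> (Ht \<i> 0) +
      Re (jpart p) * \<psi> (Ht 0 1) + Im (jpart p) * \<psi> (Ht 0 \<i>)"
    by (metis add scale real_scaleR_def)
  also have "\<dots> = Re (cpart (ht_mult t ?h p))"
    using \<open>t \<noteq> 0\<close> by (simp add: ht_mult_def field_simps)
  finally show "\<psi> p = Re (cpart (ht_mult t ?h p))" .
qed

lemma ht_form_nondegenerate:
  assumes "t \<noteq> 0" and "\<And>p. Re (cpart (ht_mult t q p)) = 0"
  shows "q = 0"
  using assms(2)[of "Ht 1 0"] assms(2)[of "Ht \<i> 0"] assms(2)[of "Ht 0 1"] assms(2)[of "Ht 0 \<i>"] \<open>t \<noteq> 0\<close>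
  by (intro ht.expand) (simp add: ht_mult_def complex_eq_iff)

text \<open>
  If the submodule \<open>W\<close> is proper, some nonzero real functional \<open>\<phi>\<close> vanishes on it. Representing \<open>\<phi>\<close>
  on each coordinate by an element of the algebra yields a row \<open>h\<close> with \<open>\<phi> X = Re (h X)\<close>. For \<open>X\<close> in
  \<open>W\<close> also \<open>X p\<close> is in \<open>W\<close>, so \<open>Re (h X p) = 0\<close> for all \<open>p\<close>, and nondegeneracy gives \<open>h X = 0\<close>. Thus
  \<open>h\<close> annihilates \<open>W\<close>, hence \<open>h = 0\<close> and \<open>\<phi> = 0\<close>, a contradiction.
\<close>

lemma right_submodule_eq_carrier:
  assumes t: "t \<noteq> 0" and W: "W \<subseteq> carrier_mat N 1"
    and zero: "0\<^sub>m N 1 \<in> W"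
    and add: "\<And>X Y. X \<in> W \<Longrightarrow> Y \<in> W \<Longrightarrow> X + Y \<in> W"
    and mult: "\<And>X P. X \<in> W \<Longrightarrow> P \<in> carrier_mat 1 1 \<Longrightarrow> X \<odot>\<^bsub>t\<^esub> P \<in> W"
    and annihilator: "\<And>h. h \<in> carrier_mat 1 N \<Longrightarrow> (\<And>X. X \<in> W \<Longrightarrow> h \<odot>\<^bsub>t\<^esub> X = 0\<^sub>m 1 1) \<Longrightarrow> h = 0\<^sub>m 1 N"
  shows "W = carrier_mat N 1"
proof (intro subset_antisym W subsetI, rule ccontr)
  fix X\<^sub>0 :: "ht mat"
  assume X\<^sub>0: "X\<^sub>0 \<in> carrier_mat N 1" "X\<^sub>0 \<notin> W"
  \<comment> \<open>Columns are replaced by functions on all natural numbers, which form a real vector space, so that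
    the extension of linear functionals applies; entries beyond \<open>N\<close> are ignored, so \<open>V\<close> contains all
    functions that vanish below \<open>N\<close>.\<close>
  define col where "col f = mat N 1 (\<lambda>(i, _). f i)" for f :: "nat \<Rightarrow> ht"
  define V where "V = {f. col f \<in> W}"
  have "subspace V"
  proof (rule real_vector.subspaceI)
    have "col 0 = 0\<^sub>m N 1"
      by (rule eq_matI) (auto simp: col_def)
    then show "0 \<in> V"
      using zero by (simp add: V_def)
    have "col (f + g) = col f + col g" for f g
      by (rule eq_matI) (auto simp: col_def)
    then show "\<And>f g. f \<in> V \<Longrightarrow> g \<in> V \<Longrightarrow> f + g \<in> V"
      using add by (simp add: V_def)
    have "col (c *\<^sub>R f) = col f \<odot>\<^bsub>t\<^esub> mat 1 1 (\<lambda>_. Ht (of_real c) 0)" for c f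
      by (rule eq_matI)
        (auto simp: col_def scaleR_fun_def scaleR_ht_def ht_mult_def scaleR_conv_of_real mult.commute)
    then show "\<And>c f. f \<in> V \<Longrightarrow> c *\<^sub>R f \<in> V"
      using mult by (simp add: V_def)
  qed
  define f\<^sub>0 where "f\<^sub>0 = (\<lambda>i. X\<^sub>0 $$ (i, 0))"
  have col_f\<^sub>0: "col f\<^sub>0 = X\<^sub>0"
    by (rule eq_matI) (use X\<^sub>0 in \<open>auto simp: col_def f\<^sub>0_def\<close>)
  then have "f\<^sub>0 \<notin> V"
    using X\<^sub>0 by (simp add: V_def)
  then obtain \<phi> :: "(nat \<Rightarrow> ht) \<Rightarrow> real"
    where \<phi>: "linear \<phi>" "\<And>v. v \<in> V \<Longrightarrow> \<phi> v = 0" and \<phi>_f\<^sub>0: "\<phi> f\<^sub>0 \<noteq> 0"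
    using separating_functional[OF \<open>subspace V\<close>] by metis
  interpret \<phi>: linear \<phi> by (rule \<phi>(1))
  define e where "e i p = (\<lambda>k. if k = i then p else (0 :: ht))" for i :: nat and p
  have e_linear: "linear (\<lambda>p. \<phi> (e i p))" for i
  proof (rule linearI)
    have "e i (p + q) = e i p + e i q" for p q by (auto simp: e_def)
    then show "\<And>p q. \<phi> (e i (p + q)) = \<phi> (e i p) + \<phi> (e i q)" by (simp add: \<phi>.add)
    have "e i (c *\<^sub>R p) = c *\<^sub>R e i p" for c p by (auto simp: e_def scaleR_fun_def)
    then show "\<And>c p. \<phi> (e i (c *\<^sub>R p)) = c *\<^sub>R \<phi> (e i p)" by (simp add: \<phi>.scale)
  qed
  have "\<exists>h. \<forall>p. \<phi> (e i p) = Re (cpart (ht_mult t h p))" for i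
    by (rule ht_linear_functional[OF t e_linear]) blast
  then obtain \<eta> where \<eta>: "\<And>i p. \<phi> (e i p) = Re (cpart (ht_mult t (\<eta> i) p))"
    by metis
  define h where "h = mat 1 N (\<lambda>(_, i). \<eta> i)"
  have h: "h \<in> carrier_mat 1 N"
    by (simp add: h_def)
  have cpart_sum: "cpart (sum g K) = (\<Sum>k\<in>K. cpart (g k))" for g :: "nat \<Rightarrow> ht" and K
    by (induction K rule: infinite_finite_induct) simp_all
  have \<phi>_eq: "\<phi> f = Re (cpart ((h \<odot>\<^bsub>t\<^esub> col f) $$ (0, 0)))" for f
  proof -
    have trunc: "\<phi> (\<lambda>k. if k < M then f k else 0) = (\<Sum>i<M. \<phi> (e i (f i)))" for M
    proof (induction M)
      case 0
      show ?case using \<phi>.zero by (simp add: zero_fun_def)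
    next
      case (Suc M)
      have "(\<lambda>k. if k < Suc M then f k else 0) = (\<lambda>k. if k < M then f k else 0) + e M (f M)"
        by (auto simp: e_def)
      then show ?case using Suc by (simp add: \<phi>.add)
    qed
    have "col (\<lambda>k. if k < N then 0 else f k) = 0\<^sub>m N 1"
      by (rule eq_matI) (auto simp: col_def)
    then have "\<phi> (\<lambda>k. if k < N then 0 else f k) = 0"
      using zero by (intro \<phi>(2)) (simp add: V_def)
    moreover have "f = (\<lambda>k. if k < N then f k else 0) + (\<lambda>k. if k < N then 0 else f k)"
      by auto
    ultimately have "\<phi> f = (\<Sum>i<N. \<phi> (e i (f i)))"
      using trunc[of N] \<phi>.add by (metis add.right_neutral)
    then show ?thesis
      by (simp add: \<eta> h_def col_def cpart_sum)
  qed
  have "h = 0\<^sub>m 1 N"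
  proof (rule annihilator[OF h])
    fix X assume X: "X \<in> W"
    then have XN: "X \<in> carrier_mat N 1" using W by blast
    have "(h \<odot>\<^bsub>t\<^esub> X) $$ (0, 0) = 0"
    proof (rule ht_form_nondegenerate[OF t])
      fix p :: ht
      let ?P = "mat 1 1 (\<lambda>_. p)"
      have P: "?P \<in> carrier_mat 1 1" by simp
      have XP: "X \<odot>\<^bsub>t\<^esub> ?P \<in> W" by (rule mult[OF X P])
      let ?f = "\<lambda>i. (X \<odot>\<^bsub>t\<^esub> ?P) $$ (i, 0)"
      have "col ?f = X \<odot>\<^bsub>t\<^esub> ?P"
        by (rule eq_matI) (use XN in \<open>auto simp: col_def\<close>)
      then have "Re (cpart ((h \<odot>\<^bsub>t\<^esub> (X \<odot>\<^bsub>t\<^esub> ?P)) $$ (0, 0))) = 0"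
        using \<phi>(2)[of ?f] XP \<phi>_eq[of ?f] by (simp add: V_def)
      moreover have "(h \<odot>\<^bsub>t\<^esub> (X \<odot>\<^bsub>t\<^esub> ?P)) $$ (0, 0) = ((h \<odot>\<^bsub>t\<^esub> X) \<odot>\<^bsub>t\<^esub> ?P) $$ (0, 0)"
        by (simp only: hmat_mult_assoc[OF XN P])
      moreover have "((h \<odot>\<^bsub>t\<^esub> X) \<odot>\<^bsub>t\<^esub> ?P) $$ (0, 0) = ht_mult t ((h \<odot>\<^bsub>t\<^esub> X) $$ (0, 0)) p"
        using h by (subst hmat_mult_index) (auto simp del: hmat_mult_index)
      ultimately show "Re (cpart (ht_mult t ((h \<odot>\<^bsub>t\<^esub> X) $$ (0, 0)) p)) = 0"
        by simp
    qed
    then show "h \<odot>\<^bsub>t\<^esub> X = 0\<^sub>m 1 1"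
      using h XN by (intro eq_matI) (auto simp del: hmat_mult_index)
  qed
  then have "h \<odot>\<^bsub>t\<^esub> col f\<^sub>0 = 0\<^sub>m 1 1"
    by (simp add: col_def hmat_mult_zero_left[of _ N 1])
  then show False
    using \<phi>_f\<^sub>0 \<phi>_eq[of f\<^sub>0] by simp
qed

section \<open>The state space isomorphism\<close>

lemma observability_Suc:
  assumes "A \<in> carrier_mat N N"
  shows "C \<odot>\<^bsub>t\<^esub> hmat_pow t A (Suc k) = C \<odot>\<^bsub>t\<^esub> hmat_pow t A k \<odot>\<^bsub>t\<^esub> A"
  using hmat_mult_assoc[OF hmat_pow_carrier[OF assms] assms] by simp

lemma observability_add:
  assumes "A \<in> carrier_mat N N"
  shows "C \<odot>\<^bsub>t\<^esub> hmat_pow t A (j + k) = C \<odot>\<^bsub>t\<^esub> hmat_pow t A j \<odot>\<^bsub>t\<^esub> hmat_pow t A k"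
  using hmat_mult_assoc[OF hmat_pow_carrier[OF assms] hmat_pow_carrier[OF assms]]
  by (simp add: hmat_pow_add[OF assms])

text \<open>
  The map \<open>S\<close> sends a state of the first system to a state of the second one with the same output
  sequence. Such a state exists for every reachable state because the Markov parameters agree, and
  controllability makes every state reachable. The columns of \<open>S\<close> are the partners of the unit
  columns.
\<close>

lemma intertwiner_exists:
  assumes t: "t \<noteq> 0"
    and A1: "A1 \<in> carrier_mat N1 N1" and B1: "B1 \<in> carrier_mat N1 m" and C1: "C1 \<in> carrier_mat n N1"
    and A2: "A2 \<in> carrier_mat N2 N2" and B2: "B2 \<in> carrier_mat N2 m" and C2: "C2 \<in> carrier_mat n N2"
    and ctr: "controllable t N1 m A1 B1"
    and markov: "\<And>k. C1 \<odot>\<^bsub>t\<^esub> hmat_pow t A1 k \<odot>\<^bsub>t\<^esub> B1 = C2 \<odot>\<^bsub>t\<^esub> hmat_pow t A2 k \<odot>\<^bsub>t\<^esub> B2"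
  obtains S where "S \<in> carrier_mat N2 N1"
    and "\<And>k. C2 \<odot>\<^bsub>t\<^esub> hmat_pow t A2 k \<odot>\<^bsub>t\<^esub> S = C1 \<odot>\<^bsub>t\<^esub> hmat_pow t A1 k"
proof -
  define O1 where "O1 k = C1 \<odot>\<^bsub>t\<^esub> hmat_pow t A1 k" for k
  define O2 where "O2 k = C2 \<odot>\<^bsub>t\<^esub> hmat_pow t A2 k" for k
  have O1: "O1 k \<in> carrier_mat n N1" and O2: "O2 k \<in> carrier_mat n N2" for k
    unfolding O1_def O2_def
    by (rule hmat_mult_carrier[OF C1 hmat_pow_carrier[OF A1]] hmat_mult_carrier[OF C2 hmat_pow_carrier[OF A2]])+
  \<comment> \<open>The states of the first system whose output sequence is also produced by the second system.\<close>
  define W where "W = {X \<in> carrier_mat N1 1. \<exists>Y \<in> carrier_mat N2 1. \<forall>j. O1 j \<odot>\<^bsub>t\<^esub> X = O2 j \<odot>\<^bsub>t\<^esub> Y}"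
  have W_I: "X \<in> W" if "X \<in> carrier_mat N1 1" "Y \<in> carrier_mat N2 1"
    "\<And>j. O1 j \<odot>\<^bsub>t\<^esub> X = O2 j \<odot>\<^bsub>t\<^esub> Y" for X Y
    using that unfolding W_def by auto
  have reach: "column (hmat_pow t A1 k \<odot>\<^bsub>t\<^esub> B1) l \<in> W" if l: "l < m" for k l
  proof -
    let ?X = "hmat_pow t A1 k \<odot>\<^bsub>t\<^esub> B1" and ?Y = "hmat_pow t A2 k \<odot>\<^bsub>t\<^esub> B2"
    have X: "?X \<in> carrier_mat N1 m" and Y: "?Y \<in> carrier_mat N2 m"
      by (rule hmat_mult_carrier[OF hmat_pow_carrier[OF A1] B1] hmat_mult_carrier[OF hmat_pow_carrier[OF A2] B2])+
    have "O1 j \<odot>\<^bsub>t\<^esub> column ?X l = O2 j \<odot>\<^bsub>t\<^esub> column ?Y l" for j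
    proof -
      have "O1 j \<odot>\<^bsub>t\<^esub> ?X = C1 \<odot>\<^bsub>t\<^esub> hmat_pow t A1 (j + k) \<odot>\<^bsub>t\<^esub> B1"
        unfolding observability_add[OF A1] O1_def
        by (rule hmat_mult_assoc[OF hmat_pow_carrier[OF A1] B1, symmetric])
      moreover have "O2 j \<odot>\<^bsub>t\<^esub> ?Y = C2 \<odot>\<^bsub>t\<^esub> hmat_pow t A2 (j + k) \<odot>\<^bsub>t\<^esub> B2"
        unfolding observability_add[OF A2] O2_def
        by (rule hmat_mult_assoc[OF hmat_pow_carrier[OF A2] B2, symmetric])
      ultimately have "O1 j \<odot>\<^bsub>t\<^esub> ?X = O2 j \<odot>\<^bsub>t\<^esub> ?Y"
        using markov by simp
      then show ?thesis
        using column_mult[of l ?X t "O1 j"] column_mult[of l ?Y t "O2 j"] l B1 B2 by simp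
    qed
    then show ?thesis
      by (rule W_I[OF column_carrier[OF X] column_carrier[OF Y]])
  qed
  have "W = carrier_mat N1 1"
  proof (rule right_submodule_eq_carrier[OF t])
    show "W \<subseteq> carrier_mat N1 1"
      by (auto simp: W_def)
    have "O1 j \<odot>\<^bsub>t\<^esub> 0\<^sub>m N1 1 = O2 j \<odot>\<^bsub>t\<^esub> 0\<^sub>m N2 1" for j
      by (simp only: hmat_mult_zero_right[OF O1] hmat_mult_zero_right[OF O2])
    then show "0\<^sub>m N1 1 \<in> W"
      by (rule W_I[OF zero_carrier_mat zero_carrier_mat])
  next
    fix X X' assume "X \<in> W" "X' \<in> W"
    then obtain Y Y' where X: "X \<in> carrier_mat N1 1" "X' \<in> carrier_mat N1 1"
      and Y: "Y \<in> carrier_mat N2 1" "Y' \<in> carrier_mat N2 1"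
      and eq: "\<And>j. O1 j \<odot>\<^bsub>t\<^esub> X = O2 j \<odot>\<^bsub>t\<^esub> Y" "\<And>j. O1 j \<odot>\<^bsub>t\<^esub> X' = O2 j \<odot>\<^bsub>t\<^esub> Y'"
      unfolding W_def by blast
    have "O1 j \<odot>\<^bsub>t\<^esub> (X + X') = O2 j \<odot>\<^bsub>t\<^esub> (Y + Y')" for j
      by (simp only: hmat_mult_add_right[OF X] hmat_mult_add_right[OF Y] eq)
    then show "X + X' \<in> W"
      by (rule W_I[OF add_carrier_mat[OF X(2)] add_carrier_mat[OF Y(2)]])
  next
    fix X P :: "ht mat" assume "X \<in> W" and P: "P \<in> carrier_mat 1 1"
    then obtain Y where X: "X \<in> carrier_mat N1 1" and Y: "Y \<in> carrier_mat N2 1"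
      and eq: "\<And>j. O1 j \<odot>\<^bsub>t\<^esub> X = O2 j \<odot>\<^bsub>t\<^esub> Y"
      unfolding W_def by blast
    have "O1 j \<odot>\<^bsub>t\<^esub> (X \<odot>\<^bsub>t\<^esub> P) = O2 j \<odot>\<^bsub>t\<^esub> (Y \<odot>\<^bsub>t\<^esub> P)" for j
      by (simp only: hmat_mult_assoc[OF X P, symmetric] hmat_mult_assoc[OF Y P, symmetric] eq)
    then show "X \<odot>\<^bsub>t\<^esub> P \<in> W"
      by (rule W_I[OF hmat_mult_carrier[OF X P] hmat_mult_carrier[OF Y P]])
  next
    fix h assume h: "h \<in> carrier_mat 1 N1" and ann: "\<And>X. X \<in> W \<Longrightarrow> h \<odot>\<^bsub>t\<^esub> X = 0\<^sub>m 1 1"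
    have "h \<odot>\<^bsub>t\<^esub> hmat_pow t A1 k \<odot>\<^bsub>t\<^esub> B1 = 0\<^sub>m 1 m" for k
    proof (rule mat_eq_by_columns)
      show "h \<odot>\<^bsub>t\<^esub> hmat_pow t A1 k \<odot>\<^bsub>t\<^esub> B1 \<in> carrier_mat 1 m"
        by (rule hmat_mult_carrier[OF hmat_mult_carrier[OF h hmat_pow_carrier[OF A1]] B1])
      fix l assume l: "l < m"
      have "column (h \<odot>\<^bsub>t\<^esub> hmat_pow t A1 k \<odot>\<^bsub>t\<^esub> B1) l = 0\<^sub>m 1 1"
        using ann[OF reach[OF l, of k]] column_mult[of l "hmat_pow t A1 k \<odot>\<^bsub>t\<^esub> B1" t h] l B1
        by (simp add: hmat_mult_assoc[OF hmat_pow_carrier[OF A1] B1])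
      also have "\<dots> = column (0\<^sub>m 1 m) l"
        using l by (intro eq_matI) (auto simp: column_def)
      finally show "column (h \<odot>\<^bsub>t\<^esub> hmat_pow t A1 k \<odot>\<^bsub>t\<^esub> B1) l = column (0\<^sub>m 1 m) l" .
    qed simp
    then show "h = 0\<^sub>m 1 N1"
      using ctr h unfolding controllable_def by blast
  qed
  then have "column (1\<^sub>m N1) l \<in> W" for l
    using column_carrier[OF one_carrier_mat] by blast
  then have "\<forall>l. \<exists>Y \<in> carrier_mat N2 1. \<forall>j. O1 j \<odot>\<^bsub>t\<^esub> column (1\<^sub>m N1) l = O2 j \<odot>\<^bsub>t\<^esub> Y"
    unfolding W_def by blast
  then obtain Y where Y: "\<And>l. Y l \<in> carrier_mat N2 1"
    "\<And>l j. O1 j \<odot>\<^bsub>t\<^esub> column (1\<^sub>m N1) l = O2 j \<odot>\<^bsub>t\<^esub> Y l"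
    by metis
  define S where "S = mat N2 N1 (\<lambda>(i, l). Y l $$ (i, 0))"
  have S: "S \<in> carrier_mat N2 N1"
    by (simp add: S_def)
  have column_S: "column S l = Y l" if "l < N1" for l
    by (rule eq_matI) (use that Y(1)[of l] in \<open>auto simp: column_def S_def\<close>)
  have "O2 k \<odot>\<^bsub>t\<^esub> S = O1 k" for k
  proof (rule mat_eq_by_columns[OF hmat_mult_carrier[OF O2 S] O1])
    fix l assume l: "l < N1"
    have "column (O2 k \<odot>\<^bsub>t\<^esub> S) l = O1 k \<odot>\<^bsub>t\<^esub> column (1\<^sub>m N1) l"
      using l S column_mult[of l S t "O2 k"] column_S[OF l] Y(2) by simp
    also have "\<dots> = column (O1 k) l"
      using l column_mult[of l "1\<^sub>m N1" t "O1 k"] hmat_mult_one_right[OF O1] by simp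
    finally show "column (O2 k \<odot>\<^bsub>t\<^esub> S) l = column (O1 k) l" .
  qed
  then show ?thesis
    using that[OF S] by (simp only: O1_def O2_def)
qed

text \<open>
  Over this noncommutative algebra the trace of a product depends on the order of the factors, but its
  real part does not, because \<open>Re (p q) = Re (q p)\<close>.
\<close>

definition real_trace :: "ht mat \<Rightarrow> real" where
  "real_trace A = (\<Sum>i<dim_row A. Re (cpart (A $$ (i, i))))"

lemma real_trace_commute:
  assumes "A \<in> carrier_mat n k" "B \<in> carrier_mat k n"
  shows "real_trace (A \<odot>\<^bsub>t\<^esub> B) = real_trace (B \<odot>\<^bsub>t\<^esub> A)"
proof -
  have re_sum: "Re (cpart (sum g K)) = (\<Sum>k\<in>K. Re (cpart (g k)))" for g :: "nat \<Rightarrow> ht" and K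
    by (induction K rule: infinite_finite_induct) simp_all
  have comm: "Re (cpart (ht_mult t p q)) = Re (cpart (ht_mult t q p))" for p q
    by (simp add: ht_mult_def algebra_simps)
  have "real_trace (A \<odot>\<^bsub>t\<^esub> B) = (\<Sum>i<n. \<Sum>l<k. Re (cpart (ht_mult t (A $$ (i, l)) (B $$ (l, i)))))"
    using assms by (simp add: real_trace_def re_sum)
  also have "\<dots> = (\<Sum>l<k. \<Sum>i<n. Re (cpart (ht_mult t (B $$ (l, i)) (A $$ (i, l)))))"
    by (subst sum.swap) (simp add: comm)
  also have "\<dots> = real_trace (B \<odot>\<^bsub>t\<^esub> A)"
    using assms by (simp add: real_trace_def re_sum)
  finally show ?thesis .
qed

lemma real_trace_one: "real_trace (1\<^sub>m N) = real N"
  by (simp add: real_trace_def)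

lemma similarity_iff:
  assumes "A1 \<in> carrier_mat N N" "B1 \<in> carrier_mat N m" "C1 \<in> carrier_mat n N" "D \<in> carrier_mat n m"
    "A2 \<in> carrier_mat N N" "B2 \<in> carrier_mat N m" "C2 \<in> carrier_mat n N" "S \<in> carrier_mat N N"
  shows "four_block_mat S (0\<^sub>m N n) (0\<^sub>m n N) (1\<^sub>m n) \<odot>\<^bsub>t\<^esub> four_block_mat A1 B1 C1 D =
      four_block_mat A2 B2 C2 D \<odot>\<^bsub>t\<^esub> four_block_mat S (0\<^sub>m N m) (0\<^sub>m m N) (1\<^sub>m m) \<longleftrightarrow>
    S \<odot>\<^bsub>t\<^esub> A1 = A2 \<odot>\<^bsub>t\<^esub> S \<and> S \<odot>\<^bsub>t\<^esub> B1 = B2 \<and> C1 = C2 \<odot>\<^bsub>t\<^esub> S"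
proof -
  note carriers = assms hmat_mult_carrier[OF assms(8,1)] hmat_mult_carrier[OF assms(8,2)]
    hmat_mult_carrier[OF assms(5,8)] hmat_mult_carrier[OF assms(7,8)]
  have "four_block_mat S (0\<^sub>m N n) (0\<^sub>m n N) (1\<^sub>m n) \<odot>\<^bsub>t\<^esub> four_block_mat A1 B1 C1 D =
      four_block_mat (S \<odot>\<^bsub>t\<^esub> A1) (S \<odot>\<^bsub>t\<^esub> B1) C1 D"
    using carriers hmat_mult_four_block_mat[OF assms(8) zero_carrier_mat zero_carrier_mat
      one_carrier_mat assms(1-4)] by simp
  moreover have "four_block_mat A2 B2 C2 D \<odot>\<^bsub>t\<^esub> four_block_mat S (0\<^sub>m N m) (0\<^sub>m m N) (1\<^sub>m m) =
      four_block_mat (A2 \<odot>\<^bsub>t\<^esub> S) B2 (C2 \<odot>\<^bsub>t\<^esub> S) D"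
    using carriers hmat_mult_four_block_mat[OF assms(5-7,4,8) zero_carrier_mat zero_carrier_mat
      one_carrier_mat] by simp
  ultimately show ?thesis
    by (simp add: four_block_mat_inject[OF carriers(9,10,3,4,11,6,12,4)])
qed

theorem theorem3p13:
  fixes t :: real and n m N\<^sub>1 N\<^sub>2 :: nat
    and r :: "real \<Rightarrow> ht mat"
    and A\<^sub>1 B\<^sub>1 C\<^sub>1 A\<^sub>2 B\<^sub>2 C\<^sub>2 D :: "ht mat"
  assumes "t \<noteq> 0"
    and "minimal_realization t n m r N\<^sub>1 A\<^sub>1 B\<^sub>1 C\<^sub>1 D"
    and "minimal_realization t n m r N\<^sub>2 A\<^sub>2 B\<^sub>2 C\<^sub>2 D"
  shows "N\<^sub>1 = N\<^sub>2 \<and>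
    (\<exists>!S. S \<in> carrier_mat N\<^sub>1 N\<^sub>1 \<and> hmat_invertible t S \<and>
       four_block_mat S (0\<^sub>m N\<^sub>1 n) (0\<^sub>m n N\<^sub>1) (1\<^sub>m n) \<odot>\<^bsub>t\<^esub> four_block_mat A\<^sub>1 B\<^sub>1 C\<^sub>1 D =
       four_block_mat A\<^sub>2 B\<^sub>2 C\<^sub>2 D \<odot>\<^bsub>t\<^esub> four_block_mat S (0\<^sub>m N\<^sub>1 m) (0\<^sub>m m N\<^sub>1) (1\<^sub>m m))"
proof -
  have R: "is_realization t n m r N\<^sub>1 A\<^sub>1 B\<^sub>1 C\<^sub>1 D" "is_realization t n m r N\<^sub>2 A\<^sub>2 B\<^sub>2 C\<^sub>2 D"
    and obs1: "observable t n N\<^sub>1 C\<^sub>1 A\<^sub>1" and obs2: "observable t n N\<^sub>2 C\<^sub>2 A\<^sub>2"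
    and ctr1: "controllable t N\<^sub>1 m A\<^sub>1 B\<^sub>1" and ctr2: "controllable t N\<^sub>2 m A\<^sub>2 B\<^sub>2"
    using assms(2,3) by (auto simp: minimal_realization_def)
  have A1: "A\<^sub>1 \<in> carrier_mat N\<^sub>1 N\<^sub>1" and B1: "B\<^sub>1 \<in> carrier_mat N\<^sub>1 m" and C1: "C\<^sub>1 \<in> carrier_mat n N\<^sub>1"
    and A2: "A\<^sub>2 \<in> carrier_mat N\<^sub>2 N\<^sub>2" and B2: "B\<^sub>2 \<in> carrier_mat N\<^sub>2 m" and C2: "C\<^sub>2 \<in> carrier_mat n N\<^sub>2"
    and D: "D \<in> carrier_mat n m"
    using R unfolding is_realization_def by blast+
  note markov = markov_parameters_eq[OF R obs1 obs2]
  define O1 where "O1 k = C\<^sub>1 \<odot>\<^bsub>t\<^esub> hmat_pow t A\<^sub>1 k" for k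
  define O2 where "O2 k = C\<^sub>2 \<odot>\<^bsub>t\<^esub> hmat_pow t A\<^sub>2 k" for k
  have O1: "O1 k \<in> carrier_mat n N\<^sub>1" and O2: "O2 k \<in> carrier_mat n N\<^sub>2" for k
    unfolding O1_def O2_def
    by (rule hmat_mult_carrier[OF C1 hmat_pow_carrier[OF A1]] hmat_mult_carrier[OF C2 hmat_pow_carrier[OF A2]])+
  have O1_Suc: "O1 (Suc k) = O1 k \<odot>\<^bsub>t\<^esub> A\<^sub>1" and O2_Suc: "O2 (Suc k) = O2 k \<odot>\<^bsub>t\<^esub> A\<^sub>2" for k
    unfolding O1_def O2_def by (rule observability_Suc[OF A1] observability_Suc[OF A2])+
  have O1_0: "O1 0 = C\<^sub>1" and O2_0: "O2 0 = C\<^sub>2"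
    using A1 A2 C1 C2 by (simp_all add: O1_def O2_def)
  have cancel1: "X = Y" if "X \<in> carrier_mat N\<^sub>1 p" "Y \<in> carrier_mat N\<^sub>1 p"
    "\<And>k. O1 k \<odot>\<^bsub>t\<^esub> X = O1 k \<odot>\<^bsub>t\<^esub> Y" for X Y p
    using observable_cancel[OF obs1 A1 C1 that(1,2)] that(3) by (simp add: O1_def)
  have cancel2: "X = Y" if "X \<in> carrier_mat N\<^sub>2 p" "Y \<in> carrier_mat N\<^sub>2 p"
    "\<And>k. O2 k \<odot>\<^bsub>t\<^esub> X = O2 k \<odot>\<^bsub>t\<^esub> Y" for X Y p
    using observable_cancel[OF obs2 A2 C2 that(1,2)] that(3) by (simp add: O2_def)
  obtain S where S: "S \<in> carrier_mat N\<^sub>2 N\<^sub>1" and O2_S: "\<And>k. O2 k \<odot>\<^bsub>t\<^esub> S = O1 k"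
    using intertwiner_exists[OF assms(1) A1 B1 C1 A2 B2 C2 ctr1 markov] unfolding O1_def O2_def by metis
  obtain T where T: "T \<in> carrier_mat N\<^sub>1 N\<^sub>2" and O1_T: "\<And>k. O1 k \<odot>\<^bsub>t\<^esub> T = O2 k"
    using intertwiner_exists[OF assms(1) A2 B2 C2 A1 B1 C1 ctr2 markov[symmetric]] unfolding O1_def O2_def
    by metis
  have ST: "S \<odot>\<^bsub>t\<^esub> T = 1\<^sub>m N\<^sub>2"
    by (rule cancel2[OF hmat_mult_carrier[OF S T] one_carrier_mat])
      (simp only: hmat_mult_assoc[OF S T, symmetric] O2_S O1_T hmat_mult_one_right[OF O2])
  have TS: "T \<odot>\<^bsub>t\<^esub> S = 1\<^sub>m N\<^sub>1"
    by (rule cancel1[OF hmat_mult_carrier[OF T S] one_carrier_mat])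
      (simp only: hmat_mult_assoc[OF T S, symmetric] O2_S O1_T hmat_mult_one_right[OF O1])
  have "real N\<^sub>1 = real N\<^sub>2"
    using real_trace_commute[OF S T, of t] by (simp only: ST TS real_trace_one)
  then have N: "N\<^sub>1 = N\<^sub>2" by simp
  note similarity = similarity_iff[OF A1 B1 C1 D A2[folded N] B2[folded N] C2[folded N]]
  have SA: "S \<odot>\<^bsub>t\<^esub> A\<^sub>1 = A\<^sub>2 \<odot>\<^bsub>t\<^esub> S"
    by (rule cancel2[OF hmat_mult_carrier[OF S A1] hmat_mult_carrier[OF A2 S]])
      (simp only: hmat_mult_assoc[OF S A1, symmetric] hmat_mult_assoc[OF A2 S, symmetric]
        O2_S O1_Suc[symmetric] O2_Suc[symmetric])
  have SB: "S \<odot>\<^bsub>t\<^esub> B\<^sub>1 = B\<^sub>2"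
    by (rule cancel2[OF hmat_mult_carrier[OF S B1] B2])
      (simp only: hmat_mult_assoc[OF S B1, symmetric] O2_S, simp only: O1_def O2_def markov)
  have CS: "C\<^sub>1 = C\<^sub>2 \<odot>\<^bsub>t\<^esub> S"
    using O2_S[of 0] by (simp only: O1_0 O2_0)
  have "\<exists>!S. S \<in> carrier_mat N\<^sub>1 N\<^sub>1 \<and> hmat_invertible t S \<and>
      four_block_mat S (0\<^sub>m N\<^sub>1 n) (0\<^sub>m n N\<^sub>1) (1\<^sub>m n) \<odot>\<^bsub>t\<^esub> four_block_mat A\<^sub>1 B\<^sub>1 C\<^sub>1 D =
      four_block_mat A\<^sub>2 B\<^sub>2 C\<^sub>2 D \<odot>\<^bsub>t\<^esub> four_block_mat S (0\<^sub>m N\<^sub>1 m) (0\<^sub>m m N\<^sub>1) (1\<^sub>m m)"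
  proof (intro ex1I conjI)
    show S_square: "S \<in> carrier_mat N\<^sub>1 N\<^sub>1"
      using S N by simp
    have "is_hmat_inverse t S T"
      using S T ST TS N by (auto simp: is_hmat_inverse_def)
    then show "hmat_invertible t S"
      unfolding hmat_invertible_def by blast
    show "four_block_mat S (0\<^sub>m N\<^sub>1 n) (0\<^sub>m n N\<^sub>1) (1\<^sub>m n) \<odot>\<^bsub>t\<^esub> four_block_mat A\<^sub>1 B\<^sub>1 C\<^sub>1 D =
      four_block_mat A\<^sub>2 B\<^sub>2 C\<^sub>2 D \<odot>\<^bsub>t\<^esub> four_block_mat S (0\<^sub>m N\<^sub>1 m) (0\<^sub>m m N\<^sub>1) (1\<^sub>m m)"
      using similarity[OF S_square] SA SB CS by blast
  next
    fix S'
    assume S': "S' \<in> carrier_mat N\<^sub>1 N\<^sub>1 \<and> hmat_invertible t S' \<and>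
      four_block_mat S' (0\<^sub>m N\<^sub>1 n) (0\<^sub>m n N\<^sub>1) (1\<^sub>m n) \<odot>\<^bsub>t\<^esub> four_block_mat A\<^sub>1 B\<^sub>1 C\<^sub>1 D =
      four_block_mat A\<^sub>2 B\<^sub>2 C\<^sub>2 D \<odot>\<^bsub>t\<^esub> four_block_mat S' (0\<^sub>m N\<^sub>1 m) (0\<^sub>m m N\<^sub>1) (1\<^sub>m m)"
    then have S'_carrier: "S' \<in> carrier_mat N\<^sub>2 N\<^sub>1"
      and S'A: "A\<^sub>2 \<odot>\<^bsub>t\<^esub> S' = S' \<odot>\<^bsub>t\<^esub> A\<^sub>1" and CS': "C\<^sub>2 \<odot>\<^bsub>t\<^esub> S' = C\<^sub>1"
      using similarity[of S'] N by auto
    have "O2 k \<odot>\<^bsub>t\<^esub> S' = O1 k" for k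
    proof (induction k)
      case 0
      show ?case by (simp only: O1_0 O2_0 CS')
    next
      case (Suc k)
      show ?case
        by (simp only: O2_Suc O1_Suc hmat_mult_assoc[OF A2 S'_carrier] S'A
          hmat_mult_assoc[OF S'_carrier A1, symmetric] Suc)
    qed
    then show "S' = S"
      by (intro cancel2[OF S'_carrier S]) (simp add: O2_S)
  qed
  then show ?thesis using N by blast
qed

end
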